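(* For any transcendental real number $\zeta$, \[\frac{(\overline{w}(\zeta)+1)^2}{4\overline{w}(\zeta)}\le\overline{\lambda}(\zeta),\qquad \frac{(\underline{w}(\zeta)+1)^2}{4\underline{w}(\zeta)}\le\underline{\lambda}(\zeta).\] In particular, every $T$-number $\zeta$ satisfies $\limsup_{n\to\infty}n\lambda_n(\zeta)=\infty$.
   Context: $H(P)$ is the maximum modulus of the coefficients of $P\in\mathbb{Z}[T]$. $w_n(\zeta)$: supremum of $w$ such that $0<|P(\zeta)|\le H(P)^{-w}$ has infinitely many solutions $P\in\mathbb{Z}[T]$ of degree $\le n$. $\lambda_n(\zeta)$: supremum of $\lambda$ such that $1\le|x|\le X$, $\max_{1\le i\le n}|\zeta^ix-y_i|\le X^{-\lambda}$ has an integer solution for arbitrarily large $X$. $\overline{w}(\zeta)=\limsup w_n(\zeta)/n$, $\underline{w}(\zeta)=\liminf w_n(\zeta)/n$, $\overline{\lambda}(\zeta)=\limsup n\lambda_n(\zeta)$, $\underline{\lambda}(\zeta)=\liminf n\lambda_n(\zeta)$. A $T$-number is a $\zeta$ with $w_n(\zeta)<\infty$ for all $n$ and $\limsup w_n(\zeta)/n=\infty$. Values are in the extended reals. *)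

theory Defs
  imports Complex_Main "HOL-Library.Extended_Real" "HOL-Computational_Algebra.Polynomial"
begin

definition height :: "int poly \<Rightarrow> int" where
  "height P = Max ((\<lambda>i. \<bar>coeff P i\<bar>) ` {..degree P})"

definition w_exp :: "nat \<Rightarrow> real \<Rightarrow> ereal" where
  "w_exp n \<zeta> = Sup {ereal w | w :: real.
     infinite {P :: int poly. degree P \<le> n \<and> 0 < \<bar>poly (map_poly real_of_int P) \<zeta>\<bar> \<and>
                 \<bar>poly (map_poly real_of_int P) \<zeta>\<bar> \<le> real_of_int (height P) powr (- w)}}"

definition lambda_exp :: "nat \<Rightarrow> real \<Rightarrow> ereal" where
  "lambda_exp n \<zeta> = Sup {ereal l | l :: real.
     \<exists>\<^sub>F X :: real in at_top. \<exists>(x :: int) (y :: nat \<Rightarrow> int).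
       1 \<le> \<bar>x\<bar> \<and> real_of_int \<bar>x\<bar> \<le> X \<and>
       (\<forall>i\<in>{1..n}. \<bar>\<zeta> ^ i * real_of_int x - real_of_int (y i)\<bar> \<le> X powr (- l))}"

definition w_upper :: "real \<Rightarrow> ereal" where
  "w_upper \<zeta> = limsup (\<lambda>n. w_exp n \<zeta> / ereal (real n))"

definition w_lower :: "real \<Rightarrow> ereal" where
  "w_lower \<zeta> = liminf (\<lambda>n. w_exp n \<zeta> / ereal (real n))"

definition lambda_upper :: "real \<Rightarrow> ereal" where
  "lambda_upper \<zeta> = limsup (\<lambda>n. ereal (real n) * lambda_exp n \<zeta>)"

definition lambda_lower :: "real \<Rightarrow> ereal" where
  "lambda_lower \<zeta> = liminf (\<lambda>n. ereal (real n) * lambda_exp n \<zeta>)"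

definition T_number :: "real \<Rightarrow> bool" where
  "T_number \<zeta> \<longleftrightarrow> (\<forall>n. w_exp n \<zeta> < \<infinity>) \<and> limsup (\<lambda>n. w_exp n \<zeta> / ereal (real n)) = \<infinity>"

text \<open>
  The expression \<open>(w + 1)\<^sup>2 / (4 w)\<close>, extended to \<open>w = \<infinity>\<close> by its limit \<open>\<infinity>\<close>.
  The case distinction is needed because \<open>\<infinity> / \<infinity> = 0\<close> in type \<open>ereal\<close>.
\<close>

definition spectrum_bound :: "ereal \<Rightarrow> ereal" where
  "spectrum_bound w = (if w = \<infinity> then \<infinity> else (w + 1)\<^sup>2 / (4 * w))"

end

theory Submission
  imports Defs "HOL-Real_Asymp.Real_Asymp" "HOL-Library.FuncSet"
begin

text \<open>
  A polynomial \<open>P\<close> of degree at most \<open>n\<close> and height \<open>H\<close> with \<open>\<bar>P(\<zeta>)\<bar> \<le> H powr (- w)\<close> yields, for every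
  \<open>N \<ge> n\<close>, good simultaneous approximations to \<open>\<zeta>, \<dots>, \<zeta> ^ N\<close>: one looks for them among the integer
  sequences satisfying the linear recurrence with characteristic polynomial \<open>P\<close>. The sequences
  \<open>\<lambda>i. \<lfloor>x * \<zeta> ^ i\<rfloor>\<close> violate the recurrence by integers of size \<open>O(H)\<close> only, because \<open>P(\<zeta>)\<close> is small.
  The pigeonhole principle, applied to these \<open>N - n + 1\<close> defects and to the fractional parts of the
  first \<open>n\<close> terms, gives two of them whose difference is an exact solution with small initial errors.
  If the leading coefficient of the recurrence is comparable to \<open>H\<close>, the later errors stay small, and
  one obtains \<open>x\<close> of size \<open>H powr \<xi>\<close> with errors of size \<open>H powr (- \<beta>)\<close>, where
  \<open>\<xi> = (w (n - 1) + N) / n\<close> and \<open>\<beta> = (w + n - N) / n\<close>. Replacing \<open>\<zeta>\<close> by \<open>1 / (\<zeta> - a)\<close>, which makes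
  \<open>P(a)\<close> the leading coefficient, reduces to this case. Hence
  \<open>\<lambda>\<^sub>N \<ge> (w\<^sub>n + n - N) / (w\<^sub>n (n - 1) + N)\<close>. With \<open>w\<^sub>n\<close> close to \<open>w n\<close> and \<open>N\<close> close to \<open>t n\<close>
  this gives \<open>N \<lambda>\<^sub>N \<ge> t (w + 1 - t) / w\<close> in the limit, and \<open>t = (w + 1) / 2 \<ge> 1\<close> is optimal.
\<close>

section \<open>Pigeonhole principles\<close>

lemma pigeonhole_boxes:
  fixes f :: "'a \<Rightarrow> 'i \<Rightarrow> real" and lo \<delta> :: "'i \<Rightarrow> real" and r :: "'i \<Rightarrow> nat"
  assumes "finite J" and \<delta>: "\<And>j. j \<in> J \<Longrightarrow> 0 < \<delta> j"
    and range: "\<And>x j. x \<in> A \<Longrightarrow> j \<in> J \<Longrightarrow> f x j \<in> {lo j..<lo j + real (r j) * \<delta> j}"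
    and card: "(\<Prod>j\<in>J. r j) < card A"
  obtains x y where "x \<in> A" "y \<in> A" "x \<noteq> y" "\<And>j. j \<in> J \<Longrightarrow> \<bar>f x j - f y j\<bar> < \<delta> j"
proof -
  define cell where "cell x = (\<lambda>j\<in>J. \<lfloor>(f x j - lo j) / \<delta> j\<rfloor>)" for x
  let ?cells = "PiE J (\<lambda>j. {0..<int (r j)})"
  have "\<lfloor>(f x j - lo j) / \<delta> j\<rfloor> \<in> {0..<int (r j)}" if "x \<in> A" "j \<in> J" for x j
    using range[OF that] \<delta>[OF that(2)] by (auto simp: floor_less_iff field_simps)
  then have "cell ` A \<subseteq> ?cells" by (auto simp: cell_def)
  then have "card (cell ` A) \<le> card ?cells"
    using \<open>finite J\<close> by (intro card_mono finite_PiE) auto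
  also have "\<dots> < card A" using card \<open>finite J\<close> by (simp add: card_PiE)
  finally obtain x y where xy: "x \<in> A" "y \<in> A" "x \<noteq> y" "cell x = cell y"
    using pigeonhole unfolding inj_on_def by blast
  have "\<bar>f x j - f y j\<bar> < \<delta> j" if j: "j \<in> J" for j
  proof -
    have "\<lfloor>(f x j - lo j) / \<delta> j\<rfloor> = \<lfloor>(f y j - lo j) / \<delta> j\<rfloor>"
      using fun_cong[OF xy(4), of j] j by (simp add: cell_def)
    then have "\<bar>(f x j - lo j) / \<delta> j - (f y j - lo j) / \<delta> j\<bar> < 1" by linarith
    then show ?thesis using \<delta>[OF j] by (simp add: abs_less_iff field_simps)
  qed
  with xy show thesis by (intro that)
qed

lemma pigeonhole_frac_int:
  fixes \<alpha> :: "'a \<Rightarrow> 'i \<Rightarrow> real" and d :: "'a \<Rightarrow> 'j \<Rightarrow> int" and B R :: nat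
  assumes fin: "finite I" "finite J" and B: "1 \<le> B"
    and d: "\<And>x j. x \<in> A \<Longrightarrow> j \<in> J \<Longrightarrow> \<bar>d x j\<bar> \<le> int R"
    and card: "B ^ card I * (2 * R + 1) ^ card J < card A"
  obtains x y where "x \<in> A" "y \<in> A" "x \<noteq> y"
    "\<And>i. i \<in> I \<Longrightarrow> \<bar>frac (\<alpha> x i) - frac (\<alpha> y i)\<bar> < 1 / B" "\<And>j. j \<in> J \<Longrightarrow> d x j = d y j"
proof -
  define f where "f x = case_sum (\<lambda>i. frac (\<alpha> x i)) (\<lambda>j. of_int (d x j))" for x
  define lo :: "'i + 'j \<Rightarrow> real" where "lo = case_sum (\<lambda>_. 0) (\<lambda>_. - R)"
  define \<delta> :: "'i + 'j \<Rightarrow> real" where "\<delta> = case_sum (\<lambda>_. 1 / B) (\<lambda>_. 1)"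
  define r :: "'i + 'j \<Rightarrow> nat" where "r = case_sum (\<lambda>_. B) (\<lambda>_. 2 * R + 1)"
  have "f x (Inr j) \<in> {lo (Inr j)..<lo (Inr j) + real (r (Inr j)) * \<delta> (Inr j)}"
    if "x \<in> A" "j \<in> J" for x j
    using d[OF that] by (simp add: f_def lo_def \<delta>_def r_def abs_le_iff)
  moreover have "f x (Inl i) \<in> {lo (Inl i)..<lo (Inl i) + real (r (Inl i)) * \<delta> (Inl i)}" for x i
    using B by (simp add: f_def lo_def \<delta>_def r_def frac_lt_1)
  ultimately have range: "f x k \<in> {lo k..<lo k + real (r k) * \<delta> k}" if "x \<in> A" "k \<in> I <+> J" for x k
    using that by auto
  have prod: "(\<Prod>k\<in>I <+> J. r k) < card A" using fin card by (simp add: prod.Plus r_def)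
  have pos: "0 < \<delta> k" for k using B by (simp add: \<delta>_def split: sum.split)
  obtain x y where xy: "x \<in> A" "y \<in> A" "x \<noteq> y"
    and close: "\<And>k. k \<in> I <+> J \<Longrightarrow> \<bar>f x k - f y k\<bar> < \<delta> k"
    by (rule pigeonhole_boxes[of "I <+> J" \<delta> A f lo r, OF finite_Plus[OF fin] pos range prod]) blast+
  have "d x j = d y j" if "j \<in> J" for j
    using close[OF InrI[OF that]] by (simp add: f_def \<delta>_def flip: of_int_diff of_int_abs)
  moreover have "\<bar>frac (\<alpha> x i) - frac (\<alpha> y i)\<bar> < 1 / B" if "i \<in> I" for i
    using close[OF InlI[OF that]] by (simp add: f_def \<delta>_def)
  ultimately show thesis using xy by (intro that)
qed

section \<open>Integer polynomials and their heights\<close>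

abbreviation eval_int_poly :: "int poly \<Rightarrow> real \<Rightarrow> real" where
  "eval_int_poly P x \<equiv> poly (map_poly real_of_int P) x"

lemma eval_int_poly_conv_sum:
  assumes "degree P \<le> n"
  shows "eval_int_poly P x = (\<Sum>k\<le>n. of_int (coeff P k) * x ^ k)"
proof -
  have "degree (map_poly real_of_int P) = degree P" by (simp add: degree_map_poly)
  then show ?thesis
    unfolding poly_altdef using assms
    by (intro sum.mono_neutral_cong_left) (auto simp: coeff_map_poly coeff_eq_0)
qed

lemma eval_int_poly_diff: "eval_int_poly (P - Q) x = eval_int_poly P x - eval_int_poly Q x"
proof -
  have "map_poly real_of_int (P - Q) = map_poly real_of_int P - map_poly real_of_int Q"
    by (rule poly_eqI) (simp add: coeff_map_poly)
  then show ?thesis by simp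
qed

lemma eval_int_poly_of_int: "eval_int_poly P (of_int a) = of_int (poly P a)"
  by (induction P) (auto simp: map_poly_pCons)

lemma eval_int_poly_nonzero:
  assumes "\<not> algebraic \<zeta>" "P \<noteq> 0"
  shows "eval_int_poly P \<zeta> \<noteq> 0"
proof
  assume "eval_int_poly P \<zeta> = 0"
  then have "algebraic \<zeta>"
    using \<open>P \<noteq> 0\<close>
    by (intro algebraicI[of "map_poly real_of_int P"]) (auto simp: coeff_map_poly map_poly_eq_0_iff)
  with \<open>\<not> algebraic \<zeta>\<close> show False by simp
qed

lemma abs_coeff_le_height: "\<bar>coeff P i\<bar> \<le> height P"
proof (cases "i \<le> degree P")
  case True
  then show ?thesis unfolding height_def by (intro Max_ge) auto
next
  case False
  have "0 \<le> \<bar>coeff P 0\<bar>" by simp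
  also have "\<bar>coeff P 0\<bar> \<le> height P" unfolding height_def by (intro Max_ge) auto
  finally show ?thesis using False by (simp add: coeff_eq_0)
qed

lemma height_le_iff: "height P \<le> M \<longleftrightarrow> (\<forall>i. \<bar>coeff P i\<bar> \<le> M)"
proof
  assume "\<forall>i. \<bar>coeff P i\<bar> \<le> M"
  then show "height P \<le> M" unfolding height_def by (subst Max_le_iff) auto
qed (use abs_coeff_le_height order_trans in blast)

lemma height_ge_1:
  assumes "P \<noteq> 0"
  shows "1 \<le> height P"
proof -
  have "1 \<le> \<bar>lead_coeff P\<bar>" using assms by (simp add: int_one_le_iff_zero_less)
  also have "\<dots> \<le> height P" by (rule abs_coeff_le_height)
  finally show ?thesis .
qed

lemma abs_eval_int_poly_le:
  fixes x :: real
  assumes "degree P \<le> n"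
  shows "\<bar>eval_int_poly P x\<bar> \<le> height P * (\<Sum>k\<le>n. \<bar>x\<bar> ^ k)"
proof -
  have "\<bar>eval_int_poly P x\<bar> \<le> (\<Sum>k\<le>n. \<bar>of_int (coeff P k) * x ^ k\<bar>)"
    unfolding eval_int_poly_conv_sum[OF assms] by (rule sum_abs)
  also have "\<dots> \<le> (\<Sum>k\<le>n. height P * \<bar>x\<bar> ^ k)"
    using abs_coeff_le_height[of P]
    by (intro sum_mono) (simp add: abs_mult power_abs mult_right_mono flip: of_int_abs)
  finally show ?thesis by (simp add: sum_distrib_left)
qed

lemma one_le_sum_powers:
  fixes x :: "'a :: linordered_idom"
  shows "1 \<le> (\<Sum>k\<le>n. \<bar>x\<bar> ^ k)"
  using member_le_sum[of 0 "{..n}" "\<lambda>k. \<bar>x\<bar> ^ k"] by simp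

lemma bij_betw_coeff_PiE:
  assumes "0 \<in> C"
  shows "bij_betw (\<lambda>P. restrict (coeff P) {..n}) {P. degree P \<le> n \<and> range (coeff P) \<subseteq> C}
           ({..n} \<rightarrow>\<^sub>E C)"
proof (rule bij_betw_byWitness[where f' = "\<lambda>f. Poly (map f [0..<Suc n])"])
  have coeff: "coeff (Poly (map f [0..<Suc n])) i = (if i \<le> n then f i else 0)"
    for f :: "nat \<Rightarrow> 'a" and i
    by (auto simp: nth_default_def simp del: upt_Suc)
  show "\<forall>P\<in>{P. degree P \<le> n \<and> range (coeff P) \<subseteq> C}.
      Poly (map (restrict (coeff P) {..n}) [0..<Suc n]) = P"
    by (auto intro!: poly_eqI simp: coeff coeff_eq_0 simp del: upt_Suc coeff_Poly_eq)
  show "\<forall>f\<in>{..n} \<rightarrow>\<^sub>E C. restrict (coeff (Poly (map f [0..<Suc n]))) {..n} = f"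
    by (intro ballI ext) (auto simp: coeff restrict_def simp del: upt_Suc coeff_Poly_eq)
  show "(\<lambda>f. Poly (map f [0..<Suc n])) ` ({..n} \<rightarrow>\<^sub>E C) \<subseteq> {P. degree P \<le> n \<and> range (coeff P) \<subseteq> C}"
    using assms by (auto intro!: degree_le simp: coeff simp del: upt_Suc coeff_Poly_eq)
qed (auto split: if_splits)

lemma finite_bounded_height: "finite {P :: int poly. degree P \<le> n \<and> height P \<le> M}"
proof -
  have "finite {P. degree P \<le> n \<and> range (coeff P) \<subseteq> insert 0 {-M..M}}"
    by (subst bij_betw_finite[OF bij_betw_coeff_PiE]) (auto intro!: finite_PiE)
  then show ?thesis
    by (rule rev_finite_subset) (auto simp: height_le_iff abs_le_iff minus_le_iff)
qed

lemma frequently_height: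
  assumes "infinite S" and "\<And>P. P \<in> S \<Longrightarrow> degree P \<le> n"
  shows "\<exists>\<^sub>F H in at_top. \<exists>P\<in>S. H = real_of_int (height P)"
  unfolding frequently_def eventually_at_top_linorder
proof (rule notI, elim exE)
  fix H0 assume H0: "\<forall>H\<ge>H0. \<not> (\<exists>P\<in>S. H = real_of_int (height P))"
  have "height P \<le> \<lfloor>H0\<rfloor>" if "P \<in> S" for P
  proof -
    have "\<not> H0 \<le> height P" using H0 that by blast
    then show ?thesis by linarith
  qed
  with assms(2) have "S \<subseteq> {P. degree P \<le> n \<and> height P \<le> \<lfloor>H0\<rfloor>}" by auto
  with \<open>infinite S\<close> finite_bounded_height finite_subset show False by blast
qed

lemma dirichlet_small_poly:
  fixes \<zeta> :: real and n Q :: nat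
  assumes Q: "1 \<le> Q"
  obtains P where "P \<noteq> 0" "degree P \<le> n" "height P \<le> int Q"
    "\<bar>eval_int_poly P \<zeta>\<bar> < 3 * (\<Sum>k\<le>n. \<bar>\<zeta>\<bar> ^ k) / real Q ^ n"
proof -
  define L where "L = (\<Sum>k\<le>n. \<bar>\<zeta>\<bar> ^ k)"
  have L: "0 < L" using one_le_sum_powers[of \<zeta> n] by (simp add: L_def)
  define A where "A = {P. degree P \<le> n \<and> range (coeff P) \<subseteq> {0..int Q}}"
  have "card A = Suc Q ^ Suc n"
    using bij_betw_same_card[OF bij_betw_coeff_PiE[of "{0..int Q}" n]]
    by (simp add: A_def card_PiE nat_add_distrib)
  then have card: "Q ^ Suc n < card A" by (metis lessI power_strict_mono zero_le zero_less_Suc)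
  have range: "eval_int_poly P \<zeta> \<in> {- (Q * L)..<- (Q * L) + real (Q ^ Suc n) * (3 * L / Q ^ n)}"
    if "P \<in> A" for P
  proof -
    have P: "degree P \<le> n" "height P \<le> int Q"
      using that by (auto simp: A_def height_le_iff subset_eq abs_le_iff intro: order_trans)
    have "\<bar>eval_int_poly P \<zeta>\<bar> \<le> height P * L"
      unfolding L_def by (rule abs_eval_int_poly_le[OF P(1)])
    also have "\<dots> \<le> Q * L" using P(2) L by (intro mult_right_mono) linarith+
    finally have "\<bar>eval_int_poly P \<zeta>\<bar> \<le> Q * L" .
    moreover have width: "real (Q ^ Suc n) * (3 * L / Q ^ n) = 3 * (Q * L)" and "0 < Q * L"
      using Q L by auto
    ultimately show ?thesis unfolding width atLeastLessThan_iff by linarith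
  qed
  obtain P P' where PP': "P \<in> A" "P' \<in> A" "P \<noteq> P'"
    and diff: "\<bar>eval_int_poly P \<zeta> - eval_int_poly P' \<zeta>\<bar> < 3 * L / Q ^ n"
    by (rule pigeonhole_boxes[of "{()}" "\<lambda>_. 3 * L / Q ^ n" A "\<lambda>P _. eval_int_poly P \<zeta>"
          "\<lambda>_. - (Q * L)" "\<lambda>_. Q ^ Suc n"])
      (use Q L card range in auto)
  have "degree (P - P') \<le> n" using PP' by (auto simp: A_def intro: degree_diff_le)
  have "\<bar>coeff P k - coeff P' k\<bar> \<le> int Q" for k
  proof -
    have "coeff P k \<in> {0..int Q}" "coeff P' k \<in> {0..int Q}" using PP' unfolding A_def by blast+
    then show ?thesis by auto
  qed
  then have "height (P - P') \<le> int Q" by (simp add: height_le_iff)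
  with \<open>degree (P - P') \<le> n\<close> show thesis
    using that[of "P - P'"] PP'(3) diff by (simp add: L_def eval_int_poly_diff)
qed

section \<open>Polynomials with small values\<close>

definition small_value_polys :: "nat \<Rightarrow> real \<Rightarrow> real \<Rightarrow> int poly set" where
  "small_value_polys n \<zeta> w = {P. degree P \<le> n \<and> 0 < \<bar>eval_int_poly P \<zeta>\<bar> \<and>
     \<bar>eval_int_poly P \<zeta>\<bar> \<le> real_of_int (height P) powr (- w)}"

lemma w_exp_altdef: "w_exp n \<zeta> = Sup {ereal w | w. infinite (small_value_polys n \<zeta> w)}"
  by (simp add: w_exp_def small_value_polys_def)

lemma small_value_polys_antimono:
  assumes "c \<le> w"
  shows "small_value_polys n \<zeta> w \<subseteq> small_value_polys n \<zeta> c"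
proof
  fix P assume P: "P \<in> small_value_polys n \<zeta> w"
  then have "P \<noteq> 0" by (auto simp: small_value_polys_def)
  then have "real_of_int (height P) powr (- w) \<le> real_of_int (height P) powr (- c)"
    using assms height_ge_1 by (intro powr_mono) auto
  with P show "P \<in> small_value_polys n \<zeta> c" by (auto simp: small_value_polys_def)
qed

lemma infinite_small_value_polys:
  assumes "ereal c < w_exp n \<zeta>"
  shows "infinite (small_value_polys n \<zeta> c)"
proof -
  obtain w where "c < w" "infinite (small_value_polys n \<zeta> w)"
    using assms unfolding w_exp_altdef less_Sup_iff by auto
  with small_value_polys_antimono[of c w] finite_subset show ?thesis by (meson less_imp_le)
qed

lemma infinite_if_arbitrarily_small:
  fixes f :: "'a \<Rightarrow> real"
  assumes "\<And>x. x \<in> S \<Longrightarrow> 0 < f x" and "\<And>\<epsilon>. 0 < \<epsilon> \<Longrightarrow> \<exists>x\<in>S. f x < \<epsilon>"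
  shows "infinite S"
proof
  assume fin: "finite S"
  have "S \<noteq> {}" using assms(2)[of 1] by auto
  then have "0 < Min (f ` S)" using fin assms(1) by (simp add: Min_gr_iff)
  with assms(2) obtain x where "x \<in> S" "f x < Min (f ` S)" by blast
  moreover have "Min (f ` S) \<le> f x" using fin \<open>x \<in> S\<close> by (intro Min_le) auto
  ultimately show False by simp
qed

lemma infinite_small_value_polys_of_transcendental:
  fixes \<zeta> :: real
  assumes tr: "\<not> algebraic \<zeta>" and w: "0 \<le> w" "w < real n"
  shows "infinite (small_value_polys n \<zeta> w)"
proof (rule infinite_if_arbitrarily_small)
  fix \<epsilon> :: real assume "0 < \<epsilon>"
  define L where "L = 3 * (\<Sum>k\<le>n. \<bar>\<zeta>\<bar> ^ k)"
  have "((\<lambda>Q. L / Q powr n) \<longlongrightarrow> 0) at_top" using w by real_asymp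
  then have "\<forall>\<^sub>F Q in at_top. L / Q powr n < \<epsilon>" using \<open>0 < \<epsilon>\<close> by (rule order_tendstoD)
  moreover have "filterlim (\<lambda>Q::real. Q powr (n - w)) at_top at_top" using w by real_asymp
  then have "\<forall>\<^sub>F Q in at_top. L \<le> Q powr (n - w)" by (simp add: filterlim_at_top)
  ultimately have "\<forall>\<^sub>F Q in at_top. L / Q powr n < \<epsilon> \<and> L \<le> Q powr (n - w) \<and> 1 \<le> Q"
    using eventually_ge_at_top[of "1::real"] by eventually_elim simp
  then have "\<forall>\<^sub>F Q :: nat in sequentially.
      L / real Q powr n < \<epsilon> \<and> L \<le> real Q powr (n - w) \<and> 1 \<le> real Q"
    by (rule eventually_compose_filterlim[OF _ filterlim_real_sequentially])
  then obtain Q :: nat where Q: "L / real Q powr n < \<epsilon>" "L \<le> real Q powr (n - w)" "1 \<le> real Q"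
    unfolding eventually_sequentially by blast
  then obtain P where P: "P \<noteq> 0" "degree P \<le> n" "height P \<le> int Q"
      "\<bar>eval_int_poly P \<zeta>\<bar> < L / real Q powr n"
    using dirichlet_small_poly[of Q n \<zeta>] by (auto simp: L_def powr_realpow)
  have "L / real Q powr n \<le> real Q powr (- w)"
    using Q by (simp add: powr_diff powr_minus field_simps)
  also have "\<dots> \<le> real_of_int (height P) powr (- w)"
    using P(3) w height_ge_1[OF P(1)] by (intro powr_mono2') auto
  finally have "P \<in> small_value_polys n \<zeta> w"
    using P eval_int_poly_nonzero[OF tr P(1)] by (simp add: small_value_polys_def)
  with P(4) Q(1) show "\<exists>P\<in>small_value_polys n \<zeta> w. \<bar>eval_int_poly P \<zeta>\<bar> < \<epsilon>" by force
qed (simp add: small_value_polys_def)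

lemma w_exp_ge:
  assumes "\<not> algebraic \<zeta>" "1 \<le> n"
  shows "ereal (real n) \<le> w_exp n \<zeta>"
proof (rule dense_le_bounded[of 0])
  fix z assume "0 < z" "z < ereal (real n)"
  then obtain w where "z = ereal w" "0 \<le> w" "w < real n" by (cases z) auto
  with infinite_small_value_polys_of_transcendental[OF assms(1)] show "z \<le> w_exp n \<zeta>"
    unfolding w_exp_altdef by (intro Sup_upper) blast
qed (use assms(2) in simp)

lemma one_le_w_lower:
  assumes "\<not> algebraic \<zeta>"
  shows "1 \<le> w_lower \<zeta>"
  unfolding w_lower_def
proof (rule Liminf_bounded)
  show "\<forall>\<^sub>F n in sequentially. 1 \<le> w_exp n \<zeta> / ereal (real n)"
    using eventually_ge_at_top[of 1]
    by eventually_elim (use w_exp_ge[OF assms] in \<open>simp add: ereal_le_divide_pos\<close>)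
qed

lemma w_lower_le_w_upper: "w_lower \<zeta> \<le> w_upper \<zeta>"
  unfolding w_lower_def w_upper_def by (rule Liminf_le_Limsup) simp

section \<open>Translates with a dominant constant coefficient\<close>

lemma poly_synthetic_div:
  fixes P :: "'a :: field poly"
  assumes "b \<noteq> a"
  shows "poly (synthetic_div P a) b = (poly P b - poly P a) / (b - a)"
proof -
  have "(b - a) * poly (synthetic_div P a) b = poly P b - poly P a"
    using arg_cong[OF synthetic_div_correct'[of a P], of "\<lambda>p. poly p b"] by (simp add: algebra_simps)
  then show ?thesis using assms by (simp add: field_simps)
qed

lemma norm_coeff_le_synthetic_div:
  fixes P :: "'a :: real_normed_field poly"
  assumes C: "\<And>j. norm (coeff (synthetic_div P a) j) \<le> C"
  shows "norm (coeff P i) \<le> norm (poly P a) + (norm a + 1) * C"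
proof -
  let ?R = "synthetic_div P a"
  have "0 \<le> C" using norm_ge_zero C by (rule order_trans)
  have "coeff P i = (if i = 0 then poly P a else 0) - a * coeff ?R i +
      (if i = 0 then 0 else coeff ?R (i - 1))"
    by (subst synthetic_div_correct'[of a P, symmetric]) (auto simp: coeff_pCons split: nat.splits)
  also have "norm \<dots> \<le> norm (if i = 0 then poly P a else 0) + norm (a * coeff ?R i) +
      norm (if i = 0 then 0 else coeff ?R (i - 1))"
    by (intro norm_triangle_le add_right_mono norm_triangle_ineq4)
  also have "\<dots> \<le> norm (poly P a) + norm a * C + C"
    using C \<open>0 \<le> C\<close> unfolding norm_mult by (intro add_mono mult_left_mono) auto
  finally show ?thesis by (simp add: algebra_simps)
qed

lemma coeff_bounded_by_values:
  fixes A :: "'a :: real_normed_field set"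
  assumes "card A = Suc n"
  shows "\<exists>C\<ge>0. \<forall>P M. degree P \<le> n \<longrightarrow> (\<forall>a\<in>A. norm (poly P a) \<le> M) \<longrightarrow> (\<forall>i. norm (coeff P i) \<le> C * M)"
  using assms
proof (induction n arbitrary: A)
  case 0
  then obtain a where A: "A = {a}" by (auto simp: card_Suc_eq)
  have "norm (coeff P i) \<le> 1 * M" if P: "degree P \<le> 0" "\<forall>a\<in>A. norm (poly P a) \<le> M" for P M i
  proof -
    obtain c where "P = [:c:]" using P(1) by (auto elim: degree_eq_zeroE)
    then show ?thesis using P(2) A order_trans[OF norm_ge_zero] by (cases i) auto
  qed
  then show ?case by (intro exI[of _ 1]) auto
next
  case (Suc n)
  then obtain a A' where A: "A = insert a A'" "a \<notin> A'" "card A' = Suc n"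
    using card_Suc_eq[THEN iffD1, OF Suc.prems] by metis
  obtain C where C: "C \<ge> 0"
    "\<And>P M i. degree P \<le> n \<Longrightarrow> (\<forall>b\<in>A'. norm (poly P b) \<le> M) \<Longrightarrow> norm (coeff P i) \<le> C * M"
    using Suc.IH[OF A(3)] by metis
  define \<delta> where "\<delta> = Min ((\<lambda>b. norm (b - a)) ` A')"
  have A': "finite A'" "A' \<noteq> {}" using A(3) by (auto simp: card_eq_0_iff intro: card_ge_0_finite)
  have \<delta>: "0 < \<delta>" using A' A(2) by (auto simp: \<delta>_def Min_gr_iff)
  have \<delta>_le: "\<delta> \<le> norm (b - a)" if "b \<in> A'" for b
    unfolding \<delta>_def using A' that by (intro Min_le) auto
  have "norm (coeff P i) \<le> (1 + (norm a + 1) * (C * (2 / \<delta>))) * M"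
    if P: "degree P \<le> Suc n" "\<forall>b\<in>A. norm (poly P b) \<le> M" for P M i
  proof -
    have "norm (poly (synthetic_div P a) b) \<le> 2 * M / \<delta>" if b: "b \<in> A'" for b
    proof -
      have "norm (poly P b - poly P a) \<le> 2 * M"
        using P(2) A(1) b by (intro norm_triangle_le_diff) fastforce
      then show ?thesis
        using b A(2) \<delta> \<delta>_le[OF b] order_trans[OF norm_ge_zero]
        by (subst poly_synthetic_div) (auto simp: norm_divide intro!: frac_le)
    qed
    then have "norm (coeff (synthetic_div P a) j) \<le> C * (2 * M / \<delta>)" for j
      using P(1) by (intro C(2)) (auto simp: degree_synthetic_div)
    then have "norm (coeff P i) \<le> norm (poly P a) + (norm a + 1) * (C * (2 * M / \<delta>))"
      by (rule norm_coeff_le_synthetic_div)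
    also have "\<dots> \<le> (1 + (norm a + 1) * (C * (2 / \<delta>))) * M"
      using P(2) A(1) by (simp add: algebra_simps)
    finally show ?thesis .
  qed
  then show ?case using C(1) \<delta> by (intro exI[of _ "1 + (norm a + 1) * (C * (2 / \<delta>))"]) auto
qed

lemma exists_dominant_translate:
  fixes A :: "'a :: real_normed_field set"
  assumes A: "card A = Suc n"
  obtains D where
    "\<And>P. degree P \<le> n \<Longrightarrow> \<exists>a\<in>A. \<forall>k. norm (coeff (pcompose P [:a, 1:]) k) \<le> D * norm (poly P a)"
proof -
  have fin: "finite A" "A \<noteq> {}" using A by (auto intro: card_ge_0_finite)
  have "\<exists>C\<ge>0. \<forall>P M. degree P \<le> n \<longrightarrow> (\<forall>b\<in>A. norm (poly P (b - a)) \<le> M) \<longrightarrow>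
      (\<forall>k. norm (coeff P k) \<le> C * M)" for a
    using coeff_bounded_by_values[of "(\<lambda>b. b - a) ` A" n] A by (simp add: card_image inj_on_def)
  then obtain C where C: "\<And>a. C a \<ge> 0" "\<And>a P M k. degree P \<le> n \<Longrightarrow>
      (\<forall>b\<in>A. norm (poly P (b - a)) \<le> M) \<Longrightarrow> norm (coeff P k) \<le> C a * M"
    by metis
  have "\<exists>a\<in>A. \<forall>k. norm (coeff (pcompose P [:a, 1:]) k) \<le> sum C A * norm (poly P a)"
    if P: "degree P \<le> n" for P
  proof -
    have "Max ((\<lambda>b. norm (poly P b)) ` A) \<in> (\<lambda>b. norm (poly P b)) ` A"
      using fin by (intro Max_in) auto
    then obtain a where a: "a \<in> A" "\<And>b. b \<in> A \<Longrightarrow> norm (poly P b) \<le> norm (poly P a)"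
      using fin(1) by (metis (no_types, lifting) Max_ge finite_imageI imageE image_eqI)
    have "norm (coeff (pcompose P [:a, 1:]) k) \<le> C a * norm (poly P a)" for k
      using a P degree_pcompose_le[of P "[:a, 1:]"] by (intro C(2)) (auto simp: poly_pcompose)
    moreover have "C a \<le> sum C A" using a(1) fin C(1) by (intro member_le_sum) auto
    ultimately show ?thesis by (meson a(1) mult_right_mono norm_ge_zero order_trans)
  qed
  then show thesis by (rule that)
qed

lemma of_int_coeff_pcompose_linear:
  fixes P :: "int poly"
  shows "of_int (coeff (pcompose P [:a, 1:]) k) =
           coeff (pcompose (map_poly of_int P) [:of_int a, 1 :: 'a :: comm_ring_1:]) k"
  by (induction P arbitrary: k)
    (auto simp: pcompose_pCons map_poly_pCons coeff_pCons split: nat.splits)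

definition dominant_value :: "nat \<Rightarrow> int poly \<Rightarrow> int \<Rightarrow> bool" where
  "dominant_value D P a \<longleftrightarrow>
     (\<forall>k. \<bar>real_of_int (coeff (pcompose P [:a, 1:]) k)\<bar> \<le> D * \<bar>real_of_int (poly P a)\<bar>)"

lemma dominant_value_nonzero:
  assumes "dominant_value D P a" "P \<noteq> 0"
  shows "poly P a \<noteq> 0"
proof
  assume "poly P a = 0"
  then have "pcompose P [:a, 1:] = 0"
    using assms(1) by (intro poly_eqI) (simp add: dominant_value_def)
  with \<open>P \<noteq> 0\<close> show False by (simp add: pcompose_eq_0_iff)
qed

lemma exists_dominant_value:
  fixes \<zeta> :: real
  obtains A :: "int set" and D :: nat where "finite A" "\<zeta> \<notin> of_int ` A"
    "\<And>P. degree P \<le> n \<Longrightarrow> \<exists>a\<in>A. dominant_value D P a"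
proof -
  define A where "A = (\<lambda>i. \<lfloor>\<zeta>\<rfloor> + 1 + int i) ` {..n}"
  have "card (real_of_int ` A) = Suc n"
    by (simp add: A_def card_image inj_on_def)
  from exists_dominant_translate[OF this] obtain D where D: "\<And>P. degree P \<le> n \<Longrightarrow>
      \<exists>a\<in>real_of_int ` A. \<forall>k. norm (coeff (pcompose P [:a, 1:]) k) \<le> D * norm (poly P a)" by metis
  obtain D' :: nat where D': "D \<le> D'" using real_arch_simple by blast
  have "\<exists>a\<in>A. dominant_value D' P a" if "degree P \<le> n" for P
  proof -
    have "degree (map_poly real_of_int P) \<le> n" using that by (simp add: degree_map_poly)
    with D obtain a where "a \<in> A" and a: "\<And>k. \<bar>real_of_int (coeff (pcompose P [:a, 1:]) k)\<bar> \<le>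
        D * \<bar>real_of_int (poly P a)\<bar>"
      by (fastforce simp: of_int_coeff_pcompose_linear eval_int_poly_of_int)
    then show ?thesis
      using mult_right_mono[OF D' abs_ge_zero] order_trans unfolding dominant_value_def by blast
  qed
  moreover have "\<zeta> \<notin> of_int ` A" by (auto simp: A_def)
  ultimately show thesis by (intro that[of A]) (auto simp: A_def)
qed

lemma abs_sum_reversed_translate_coeffs_le:
  assumes "degree P \<le> n" "\<zeta> \<noteq> of_int a"
  defines "\<eta> \<equiv> inverse (\<zeta> - of_int a)"
  shows "\<bar>\<Sum>k\<le>n. of_int (coeff (pcompose P [:a, 1:]) k) * \<eta> ^ (n - k)\<bar> \<le>
           (1 + \<bar>\<eta>\<bar>) ^ n * \<bar>eval_int_poly P \<zeta>\<bar>"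
proof -
  let ?\<theta> = "\<zeta> - of_int a" and ?Q = "pcompose P [:a, 1:]"
  have "map_poly real_of_int ?Q = pcompose (map_poly of_int P) [:of_int a, 1:]"
    by (rule poly_eqI) (simp add: coeff_map_poly of_int_coeff_pcompose_linear)
  then have "eval_int_poly P \<zeta> = eval_int_poly ?Q ?\<theta>" by (simp add: poly_pcompose)
  also have "\<dots> = (\<Sum>k\<le>n. of_int (coeff ?Q k) * ?\<theta> ^ k)"
    using assms degree_pcompose_le[of P "[:a, 1:]"] by (intro eval_int_poly_conv_sum) simp
  finally have "(\<Sum>k\<le>n. of_int (coeff ?Q k) * \<eta> ^ (n - k)) = \<eta> ^ n * eval_int_poly P \<zeta>"
    using \<open>\<zeta> \<noteq> of_int a\<close> unfolding \<eta>_def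
    by (auto simp: sum_distrib_left power_diff power_inverse field_simps intro!: sum.cong)
  then show ?thesis by (auto simp: abs_mult power_abs intro!: mult_right_mono power_mono)
qed

section \<open>Simultaneous approximation of powers\<close>

definition approximates_powers :: "nat \<Rightarrow> real \<Rightarrow> real \<Rightarrow> (nat \<Rightarrow> int) \<Rightarrow> bool" where
  "approximates_powers N \<zeta> \<epsilon> v \<longleftrightarrow> (\<forall>i\<le>N. \<bar>of_int (v i) - of_int (v 0) * \<zeta> ^ i\<bar> \<le> \<epsilon>)"

lemma approximates_powers_mono:
  assumes "approximates_powers N \<zeta> \<epsilon> v" "\<epsilon> \<le> \<epsilon>'"
  shows "approximates_powers N \<zeta> \<epsilon>' v"
  using assms order_trans unfolding approximates_powers_def by blast

definition powers_approximable :: "nat \<Rightarrow> real \<Rightarrow> real \<Rightarrow> real \<Rightarrow> bool" where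
  "powers_approximable N \<zeta> X \<epsilon> \<longleftrightarrow>
     (\<exists>v. v 0 \<noteq> 0 \<and> \<bar>real_of_int (v 0)\<bar> \<le> X \<and> approximates_powers N \<zeta> \<epsilon> v)"

lemma powers_approximable_mono:
  assumes "powers_approximable N \<zeta> X \<epsilon>" "X \<le> X'" "\<epsilon> \<le> \<epsilon>'"
  shows "powers_approximable N \<zeta> X' \<epsilon>'"
  using assms approximates_powers_mono order_trans unfolding powers_approximable_def by meson

lemma lambda_exp_ge_if_frequently_approximable:
  assumes "\<exists>\<^sub>F X in at_top. powers_approximable N \<zeta> X (X powr (- l))"
  shows "ereal l \<le> lambda_exp N \<zeta>"
  unfolding lambda_exp_def
proof (intro Sup_upper CollectI exI conjI)
  show "\<exists>\<^sub>F X :: real in at_top. \<exists>(x :: int) (y :: nat \<Rightarrow> int). 1 \<le> \<bar>x\<bar> \<and> real_of_int \<bar>x\<bar> \<le> X \<and>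
      (\<forall>i\<in>{1..N}. \<bar>\<zeta> ^ i * real_of_int x - real_of_int (y i)\<bar> \<le> X powr (- l))"
  proof (rule frequently_elim1[OF assms])
    fix X assume "powers_approximable N \<zeta> X (X powr (- l))"
    then obtain v where "v 0 \<noteq> 0" "\<bar>real_of_int (v 0)\<bar> \<le> X"
        "approximates_powers N \<zeta> (X powr (- l)) v"
      unfolding powers_approximable_def by blast
    then show "\<exists>(x :: int) (y :: nat \<Rightarrow> int). 1 \<le> \<bar>x\<bar> \<and> real_of_int \<bar>x\<bar> \<le> X \<and>
        (\<forall>i\<in>{1..N}. \<bar>\<zeta> ^ i * real_of_int x - real_of_int (y i)\<bar> \<le> X powr (- l))"
      by (intro exI[of _ "v 0"] exI[of _ v])
        (auto simp: approximates_powers_def mult.commute abs_minus_commute int_one_le_iff_zero_less)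
  qed
qed simp

lemma approximates_powers_translate:
  assumes "approximates_powers N \<zeta> \<epsilon> v" "0 \<le> \<epsilon>"
  shows "approximates_powers N (\<zeta> + of_int a) (\<epsilon> * (1 + \<bar>of_int a\<bar>) ^ N)
           (\<lambda>i. \<Sum>k\<le>i. of_nat (i choose k) * v k * a ^ (i - k))"
  unfolding approximates_powers_def
proof (intro allI impI)
  fix i assume i: "i \<le> N"
  let ?u = "\<lambda>i. \<Sum>k\<le>i. of_nat (i choose k) * v k * a ^ (i - k)"
  have "of_int (?u i) - of_int (?u 0) * (\<zeta> + of_int a) ^ i =
      (\<Sum>k\<le>i. of_nat (i choose k) * (of_int (v k) - of_int (v 0) * \<zeta> ^ k) * of_int a ^ (i - k))"
    by (simp add: binomial_ring sum_distrib_left left_diff_distrib right_diff_distrib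
        sum_subtractf mult_ac)
  also have "\<bar>\<dots>\<bar> \<le> (\<Sum>k\<le>i. of_nat (i choose k) * \<epsilon> * \<bar>of_int a\<bar> ^ (i - k))"
    using assms(1) i
    by (intro order_trans[OF sum_abs] sum_mono)
      (auto simp: approximates_powers_def abs_mult power_abs intro!: mult_mono)
  also have "\<dots> = \<epsilon> * (1 + \<bar>of_int a\<bar>) ^ i"
    by (simp add: binomial_ring sum_distrib_left mult_ac)
  also have "\<dots> \<le> \<epsilon> * (1 + \<bar>of_int a\<bar>) ^ N"
    using i \<open>0 \<le> \<epsilon>\<close> by (intro mult_left_mono power_increasing) auto
  finally show "\<bar>of_int (?u i) - of_int (?u 0) * (\<zeta> + of_int a) ^ i\<bar> \<le> \<epsilon> * (1 + \<bar>of_int a\<bar>) ^ N" .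
qed

lemma one_plus_power_le:
  fixes t :: "'a :: linordered_idom"
  assumes "0 \<le> t" "0 < i"
  shows "1 + t ^ i \<le> (1 + t) ^ i"
  using \<open>0 < i\<close>
proof (induction i rule: nat_induct_non_zero)
  case (Suc i)
  have "1 + t ^ Suc i \<le> (1 + t ^ i) * (1 + t)" using \<open>0 \<le> t\<close> by (simp add: algebra_simps)
  also have "\<dots> \<le> (1 + t) ^ i * (1 + t)" using Suc.IH \<open>0 \<le> t\<close> by (intro mult_right_mono) auto
  finally show ?case by (simp add: mult.commute)
qed simp

lemma approximates_powers_inverse:
  assumes approx: "approximates_powers N \<zeta> \<epsilon> v" and "\<zeta> \<noteq> 0"
  shows "approximates_powers N (inverse \<zeta>) (\<epsilon> * (1 + \<bar>inverse \<zeta>\<bar>) ^ N) (\<lambda>i. v (N - i))"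
  unfolding approximates_powers_def
proof (intro allI impI)
  fix i assume i: "i \<le> N"
  let ?e = "\<lambda>i. of_int (v i) - of_int (v 0) * \<zeta> ^ i"
  have e: "\<bar>?e i\<bar> \<le> \<epsilon>" if "i \<le> N" for i using approx that by (simp add: approximates_powers_def)
  have "\<zeta> ^ N * inverse \<zeta> ^ i = \<zeta> ^ (N - i)"
    using i \<open>\<zeta> \<noteq> 0\<close> by (simp add: power_diff power_inverse divide_inverse)
  then have "of_int (v (N - i)) - of_int (v N) * inverse \<zeta> ^ i = ?e (N - i) - ?e N * inverse \<zeta> ^ i"
    by (simp add: algebra_simps)
  also have "\<bar>\<dots>\<bar> \<le> \<epsilon> * (1 + \<bar>inverse \<zeta>\<bar>) ^ N"
  proof (cases "i = 0")
    case False
    have "\<bar>?e (N - i) - ?e N * inverse \<zeta> ^ i\<bar> \<le> \<bar>?e (N - i)\<bar> + \<bar>?e N\<bar> * \<bar>inverse \<zeta>\<bar> ^ i"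
      unfolding power_abs[symmetric] abs_mult[symmetric] by (rule abs_triangle_ineq4)
    also have "\<dots> \<le> \<epsilon> + \<epsilon> * \<bar>inverse \<zeta>\<bar> ^ i"
      using e i by (intro add_mono mult_right_mono) auto
    also have "\<dots> = \<epsilon> * (1 + \<bar>inverse \<zeta>\<bar> ^ i)" by (simp add: algebra_simps)
    also have "\<dots> \<le> \<epsilon> * (1 + \<bar>inverse \<zeta>\<bar>) ^ N"
      using e[of 0] i False
      by (intro mult_left_mono order_trans[OF one_plus_power_le power_increasing]) auto
    finally show ?thesis .
  qed (use e[of 0] in auto)
  finally show "\<bar>of_int (v (N - i)) - of_int (v (N - 0)) * inverse \<zeta> ^ i\<bar> \<le> \<epsilon> * (1 + \<bar>inverse \<zeta>\<bar>) ^ N"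
    by simp
qed

lemma approximates_powers_of_inverse_translate:
  assumes approx: "approximates_powers N (inverse (\<zeta> - of_int a)) \<epsilon> v" and "\<zeta> \<noteq> of_int a"
    and "v 0 \<noteq> 0" "1 \<le> N"
    and \<epsilon>: "\<epsilon> * ((1 + \<bar>\<zeta> - of_int a\<bar>) * (1 + \<bar>of_int a\<bar>)) ^ N < 1" (is "\<epsilon> * ?c ^ N < 1")
  obtains u where "u 0 \<noteq> 0"
    "\<bar>real_of_int (u 0)\<bar> \<le> \<bar>of_int (v 0)\<bar> * (1 + \<bar>inverse (\<zeta> - of_int a)\<bar>) ^ N"
    "approximates_powers N \<zeta> (\<epsilon> * ?c ^ N) u"
proof -
  define \<eta> where "\<eta> = inverse (\<zeta> - of_int a)"
  have e: "\<bar>of_int (v i) - of_int (v 0) * \<eta> ^ i\<bar> \<le> \<epsilon>" if "i \<le> N" for i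
    using approx that by (simp add: approximates_powers_def \<eta>_def)
  have \<epsilon>0: "0 \<le> \<epsilon>" using e[of 0] by simp
  define u where "u i = (\<Sum>k\<le>i. of_nat (i choose k) * v (N - k) * a ^ (i - k))" for i
  have inv: "approximates_powers N (\<zeta> - of_int a) (\<epsilon> * (1 + \<bar>\<zeta> - of_int a\<bar>) ^ N) (\<lambda>i. v (N - i))"
    using approximates_powers_inverse[OF approx] \<open>\<zeta> \<noteq> of_int a\<close> by simp
  have u: "approximates_powers N \<zeta> (\<epsilon> * ?c ^ N) u"
    using approximates_powers_translate[OF inv, of a] \<epsilon>0
    by (simp add: u_def[abs_def] power_mult_distrib mult_ac)
  have "v N \<noteq> 0"
  proof
    assume "v N = 0"
    then have "\<bar>real_of_int (v 0)\<bar> \<le> \<epsilon> * (1 + \<bar>\<zeta> - of_int a\<bar>) ^ N"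
      using inv unfolding approximates_powers_def by auto
    also have "\<dots> * 1 \<le> \<dots> * (1 + \<bar>of_int a\<bar>) ^ N" using \<epsilon>0 by (intro mult_left_mono) auto
    finally show False using \<epsilon> \<open>v 0 \<noteq> 0\<close> by (simp add: power_mult_distrib mult_ac)
  qed
  moreover have "\<bar>real_of_int (v N)\<bar> \<le> \<bar>of_int (v 0)\<bar> * (1 + \<bar>\<eta>\<bar>) ^ N"
  proof -
    have "\<epsilon> * 1 \<le> \<epsilon> * ?c ^ N" using \<epsilon>0 by (intro mult_left_mono one_le_power mult_ge1_I) auto
    with \<epsilon> \<open>v 0 \<noteq> 0\<close> have "\<epsilon> \<le> \<bar>of_int (v 0)\<bar>" by linarith
    then have "\<bar>real_of_int (v N)\<bar> \<le> \<bar>of_int (v 0)\<bar> + \<bar>of_int (v 0) * \<eta> ^ N\<bar>"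
      using e[of N] by linarith
    also have "\<dots> = \<bar>of_int (v 0)\<bar> * (1 + \<bar>\<eta>\<bar> ^ N)" by (simp add: abs_mult power_abs algebra_simps)
    also have "\<dots> \<le> \<bar>of_int (v 0)\<bar> * (1 + \<bar>\<eta>\<bar>) ^ N"
      using \<open>1 \<le> N\<close> by (intro mult_left_mono one_plus_power_le) auto
    finally show ?thesis .
  qed
  ultimately show thesis using u by (intro that[of u]) (auto simp: u_def \<eta>_def)
qed

section \<open>Linear recurrences\<close>

lemma linear_recurrence_growth:
  fixes q e :: "nat \<Rightarrow> 'a :: real_normed_field" and D E :: real
  assumes "1 \<le> n" "q 0 \<noteq> 0"
    and D: "0 \<le> D" "\<And>k. k \<in> {1..n} \<Longrightarrow> norm (q k) \<le> D * norm (q 0)"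
    and init: "\<And>i. i < n \<Longrightarrow> norm (e i) \<le> E"
    and defect: "\<And>i. i \<in> {n..N} \<Longrightarrow> norm (\<Sum>k\<le>n. q k * e (i - k)) \<le> E * norm (q 0)"
    and "i \<le> N"
  shows "norm (e i) \<le> E * (n * D + 1) ^ i"
  using \<open>i \<le> N\<close>
proof (induction i rule: less_induct)
  case (less i)
  define G where "G = n * D + 1"
  have G: "1 \<le> G" using D(1) by (simp add: G_def)
  have E: "0 \<le> E" using init[of 0] \<open>1 \<le> n\<close> order_trans[OF norm_ge_zero] by auto
  have E_le: "E \<le> E * G ^ j" for j using E G by (simp add: mult_le_cancel_left1 one_le_power)
  show ?case
  proof (cases "i < n")
    case True
    then show ?thesis using init[of i] E_le[of i] by (simp add: G_def)
  next
    case False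
    then have i: "i \<in> {n..N}" "0 < i" using less.prems \<open>1 \<le> n\<close> by auto
    have "q 0 * e i = (\<Sum>k\<le>n. q k * e (i - k)) - (\<Sum>k\<in>{1..n}. q k * e (i - k))"
      by (simp add: atMost_atLeast0 sum.atLeast_Suc_atMost)
    then have "norm (q 0) * norm (e i) \<le>
        norm (\<Sum>k\<le>n. q k * e (i - k)) + norm (\<Sum>k\<in>{1..n}. q k * e (i - k))"
      unfolding norm_mult[symmetric] by (simp add: norm_triangle_ineq4)
    also have "norm (\<Sum>k\<in>{1..n}. q k * e (i - k)) \<le> (\<Sum>k\<in>{1..n}. D * norm (q 0) * (E * G ^ (i - 1)))"
    proof (rule sum_norm_le)
      fix k assume k: "k \<in> {1..n}"
      have "norm (e (i - k)) \<le> E * G ^ (i - k)"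
        unfolding G_def using k i less.prems by (intro less.IH) auto
      also have "\<dots> \<le> E * G ^ (i - 1)"
        using E G k by (intro mult_left_mono power_increasing) auto
      finally show "norm (q k * e (i - k)) \<le> D * norm (q 0) * (E * G ^ (i - 1))"
        using D k unfolding norm_mult by (intro mult_mono) auto
    qed
    also have "norm (\<Sum>k\<le>n. q k * e (i - k)) \<le> E * G ^ (i - 1) * norm (q 0)"
      using defect[OF i(1)] mult_right_mono[OF E_le norm_ge_zero] by (rule order_trans)
    also have "E * G ^ (i - 1) * norm (q 0) + (\<Sum>k\<in>{1..n}. D * norm (q 0) * (E * G ^ (i - 1))) =
        norm (q 0) * (E * (G ^ (i - 1) * G))"
      by (simp add: G_def algebra_simps)
    also have "G ^ (i - 1) * G = G ^ i" using i(2) by (simp add: power_eq_if)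
    finally show ?thesis using \<open>q 0 \<noteq> 0\<close> by (simp add: G_def)
  qed
qed

lemma abs_recurrence_defect_geometric_le:
  fixes q :: "nat \<Rightarrow> real"
  assumes i: "i \<in> {n..N}" and c: "\<bar>c\<bar> \<le> M"
  shows "\<bar>\<Sum>k\<le>n. q k * (c * \<eta> ^ (i - k))\<bar> \<le> M * (1 + \<bar>\<eta>\<bar>) ^ N * \<bar>\<Sum>k\<le>n. q k * \<eta> ^ (n - k)\<bar>"
proof -
  have "(\<Sum>k\<le>n. q k * (c * \<eta> ^ (i - k))) = c * \<eta> ^ (i - n) * (\<Sum>k\<le>n. q k * \<eta> ^ (n - k))"
    unfolding sum_distrib_left
  proof (rule sum.cong)
    fix k assume "k \<in> {..n}"
    then have "\<eta> ^ (i - k) = \<eta> ^ (i - n) * \<eta> ^ (n - k)" using i by (simp flip: power_add)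
    then show "q k * (c * \<eta> ^ (i - k)) = c * \<eta> ^ (i - n) * (q k * \<eta> ^ (n - k))" by simp
  qed simp
  moreover have "\<bar>\<eta>\<bar> ^ (i - n) \<le> (1 + \<bar>\<eta>\<bar>) ^ N"
    using i by (intro order_trans[OF power_mono power_increasing]) auto
  ultimately show ?thesis
    using c by (auto simp: abs_mult power_abs intro!: mult_right_mono mult_mono)
qed

lemma abs_recurrence_defect_floor_le:
  fixes q :: "nat \<Rightarrow> int" and u :: "nat \<Rightarrow> real" and D :: real
  assumes D: "\<And>k. k \<le> n \<Longrightarrow> \<bar>real_of_int (q k)\<bar> \<le> D * \<bar>real_of_int (q 0)\<bar>"
    and u: "\<bar>\<Sum>k\<le>n. q k * u k\<bar> \<le> \<bar>real_of_int (q 0)\<bar>"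
  shows "\<bar>real_of_int (\<Sum>k\<le>n. q k * \<lfloor>u k\<rfloor>)\<bar> \<le> (real (n + 1) * D + 1) * \<bar>real_of_int (q 0)\<bar>"
proof -
  have "real_of_int (\<Sum>k\<le>n. q k * \<lfloor>u k\<rfloor>) = (\<Sum>k\<le>n. q k * u k) - (\<Sum>k\<le>n. q k * frac (u k))"
    by (simp add: frac_def right_diff_distrib sum_subtractf)
  moreover have "\<bar>\<Sum>k\<le>n. q k * frac (u k)\<bar> \<le> (\<Sum>k\<le>n. D * \<bar>real_of_int (q 0)\<bar> * 1)"
  proof (intro order_trans[OF sum_abs] sum_mono)
    fix k assume "k \<in> {..n}"
    then show "\<bar>q k * frac (u k)\<bar> \<le> D * \<bar>real_of_int (q 0)\<bar> * 1"
      using D[of k] frac_lt_1[of "u k"] unfolding abs_mult by (intro mult_mono) auto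
  qed
  ultimately show ?thesis using u by (simp add: algebra_simps)
qed

context
  fixes q :: "nat \<Rightarrow> int" and \<eta> :: real and D n N :: nat
begin

text \<open>
  The first factor counts the boxes of side \<open>1 / B\<close> for \<open>n - 1\<close> fractional parts, the second one
  the possible values of \<open>N - n + 1\<close> integral defects.
\<close>

definition start_range :: "nat \<Rightarrow> nat" where
  "start_range B = B ^ (n - 1) * (3 * ((n + 1) * D + 1) * nat \<bar>q 0\<bar>) ^ (N - n + 1)"

context
  assumes n: "1 \<le> n" "n \<le> N" and q0: "q 0 \<noteq> 0"
    and D: "\<And>k. k \<le> n \<Longrightarrow> \<bar>real_of_int (q k)\<bar> \<le> D * \<bar>real_of_int (q 0)\<bar>"
begin

lemma rounded_powers_equal_defects:
  assumes B: "1 \<le> B"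
    and small: "start_range B * (1 + \<bar>\<eta>\<bar>) ^ N * \<bar>\<Sum>k\<le>n. q k * \<eta> ^ (n - k)\<bar> \<le> \<bar>real_of_int (q 0)\<bar>"
  obtains x y :: int where "x \<noteq> y" "\<bar>x - y\<bar> \<le> int (start_range B)"
    "\<And>i. i \<in> {1..<n} \<Longrightarrow> \<bar>frac (of_int x * \<eta> ^ i) - frac (of_int y * \<eta> ^ i)\<bar> < 1 / B"
    "\<And>i. i \<in> {n..N} \<Longrightarrow>
       (\<Sum>k\<le>n. q k * \<lfloor>of_int x * \<eta> ^ (i - k)\<rfloor>) = (\<Sum>k\<le>n. q k * \<lfloor>of_int y * \<eta> ^ (i - k)\<rfloor>)"
proof -
  define defect where "defect x i = (\<Sum>k\<le>n. q k * \<lfloor>of_int x * \<eta> ^ (i - k)\<rfloor>)" for x :: int and i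
  define R where "R = ((n + 1) * D + 1) * nat \<bar>q 0\<bar>"
  have defect: "\<bar>defect x i\<bar> \<le> int R" if "x \<in> {0..int (start_range B)}" "i \<in> {n..N}" for x i
  proof -
    have "\<bar>\<Sum>k\<le>n. q k * (of_int x * \<eta> ^ (i - k))\<bar> \<le> \<bar>real_of_int (q 0)\<bar>"
      using that small abs_recurrence_defect_geometric_le[of i n N "of_int x" "start_range B" q \<eta>]
      by simp
    then have "\<bar>real_of_int (defect x i)\<bar> \<le> (real (n + 1) * D + 1) * \<bar>real_of_int (q 0)\<bar>"
      unfolding defect_def by (intro abs_recurrence_defect_floor_le D)
    also have "\<dots> = of_int (int R)" by (simp add: R_def algebra_simps)
    finally show ?thesis by linarith
  qed
  have "1 \<le> R" using q0 by (simp add: R_def)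
  then have "B ^ (n - 1) * (2 * R + 1) ^ (N - n + 1) \<le> B ^ (n - 1) * (3 * R) ^ (N - n + 1)"
    by (intro mult_left_mono power_mono) auto
  also have "\<dots> = start_range B" unfolding start_range_def R_def by (simp only: mult.assoc)
  also have "N - n + 1 = card {n..N}" using n by simp
  finally have "B ^ card {1..<n} * (2 * R + 1) ^ card {n..N} < card {0..int (start_range B)}"
    by simp
  then obtain x y where "x \<in> {0..int (start_range B)}" "y \<in> {0..int (start_range B)}" "x \<noteq> y"
    and "\<And>i. i \<in> {1..<n} \<Longrightarrow> \<bar>frac (of_int x * \<eta> ^ i) - frac (of_int y * \<eta> ^ i)\<bar> < 1 / B"
    and "\<And>i. i \<in> {n..N} \<Longrightarrow> defect x i = defect y i"
    using pigeonhole_frac_int[of "{1..<n}" "{n..N}" B "{0..int (start_range B)}" defect R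
        "\<lambda>x i. of_int x * \<eta> ^ i"]
      B defect by (metis finite_atLeastAtMost finite_atLeastLessThan)
  then show thesis by (intro that[of x y]) (auto simp: defect_def)
qed

lemma recurrence_solution_near_powers:
  assumes B: "1 \<le> B"
    and small: "start_range B * (1 + \<bar>\<eta>\<bar>) ^ N * \<bar>\<Sum>k\<le>n. q k * \<eta> ^ (n - k)\<bar> \<le> \<bar>real_of_int (q 0)\<bar>"
  obtains v :: "nat \<Rightarrow> int" where "v 0 \<noteq> 0" "\<bar>v 0\<bar> \<le> int (start_range B)"
    "\<And>i. i < n \<Longrightarrow> \<bar>of_int (v i) - of_int (v 0) * \<eta> ^ i\<bar> \<le> 1 / B"
    "\<And>i. i \<in> {n..N} \<Longrightarrow> (\<Sum>k\<le>n. q k * v (i - k)) = 0"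
proof -
  obtain x y :: int where xy: "x \<noteq> y" "\<bar>x - y\<bar> \<le> int (start_range B)"
    and close: "\<And>i. i \<in> {1..<n} \<Longrightarrow> \<bar>frac (of_int x * \<eta> ^ i) - frac (of_int y * \<eta> ^ i)\<bar> < 1 / B"
    and eq: "\<And>i. i \<in> {n..N} \<Longrightarrow>
      (\<Sum>k\<le>n. q k * \<lfloor>of_int x * \<eta> ^ (i - k)\<rfloor>) = (\<Sum>k\<le>n. q k * \<lfloor>of_int y * \<eta> ^ (i - k)\<rfloor>)"
    using rounded_powers_equal_defects[OF B small] by blast
  define v where "v i = \<lfloor>of_int x * \<eta> ^ i\<rfloor> - \<lfloor>of_int y * \<eta> ^ i\<rfloor>" for i
  have v0: "v 0 = x - y" by (simp add: v_def)
  show thesis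
  proof (rule that[of v])
    show "v 0 \<noteq> 0" "\<bar>v 0\<bar> \<le> int (start_range B)" using xy v0 by auto
  next
    fix i assume i: "i < n"
    have "of_int (v i) - of_int (v 0) * \<eta> ^ i = frac (of_int y * \<eta> ^ i) - frac (of_int x * \<eta> ^ i)"
      unfolding v0 by (simp add: v_def frac_def algebra_simps)
    then show "\<bar>of_int (v i) - of_int (v 0) * \<eta> ^ i\<bar> \<le> 1 / B"
      using close[of i] i by (cases "i = 0") (auto simp: v_def)
  next
    fix i assume "i \<in> {n..N}"
    then show "(\<Sum>k\<le>n. q k * v (i - k)) = 0"
      using eq by (simp add: v_def right_diff_distrib sum_subtractf)
  qed
qed

lemma recurrence_approximates_powers:
  assumes B: "1 \<le> B"
    and small: "B * start_range B * (1 + \<bar>\<eta>\<bar>) ^ N * \<bar>\<Sum>k\<le>n. q k * \<eta> ^ (n - k)\<bar> \<le> \<bar>real_of_int (q 0)\<bar>"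
  obtains v :: "nat \<Rightarrow> int" where "v 0 \<noteq> 0" "\<bar>v 0\<bar> \<le> int (start_range B)"
    "approximates_powers N \<eta> ((real n * D + 1) ^ N / B) v"
proof -
  define \<rho> where "\<rho> = start_range B * (1 + \<bar>\<eta>\<bar>) ^ N * \<bar>\<Sum>k\<le>n. q k * \<eta> ^ (n - k)\<bar>"
  have \<rho>: "real B * \<rho> \<le> \<bar>real_of_int (q 0)\<bar>" "0 \<le> \<rho>" using small by (auto simp: \<rho>_def mult_ac)
  have "1 * \<rho> \<le> real B * \<rho>" using B \<rho> by (intro mult_right_mono) auto
  with \<rho> have "\<rho> \<le> \<bar>real_of_int (q 0)\<bar>" by simp
  then obtain v :: "nat \<Rightarrow> int" where v: "v 0 \<noteq> 0" "\<bar>v 0\<bar> \<le> int (start_range B)"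
    "\<And>i. i < n \<Longrightarrow> \<bar>of_int (v i) - of_int (v 0) * \<eta> ^ i\<bar> \<le> 1 / B"
    "\<And>i. i \<in> {n..N} \<Longrightarrow> (\<Sum>k\<le>n. q k * v (i - k)) = 0"
    using recurrence_solution_near_powers[OF B] unfolding \<rho>_def by blast
  define e where "e i = of_int (v i) - of_int (v 0) * \<eta> ^ i" for i
  have defect: "\<bar>\<Sum>k\<le>n. of_int (q k) * e (i - k)\<bar> \<le> 1 / B * \<bar>real_of_int (q 0)\<bar>"
    if i: "i \<in> {n..N}" for i
  proof -
    have "(\<Sum>k\<le>n. of_int (q k) * e (i - k)) =
        of_int (\<Sum>k\<le>n. q k * v (i - k)) - (\<Sum>k\<le>n. q k * (of_int (v 0) * \<eta> ^ (i - k)))"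
      by (simp add: e_def right_diff_distrib sum_subtractf)
    then have "\<bar>\<Sum>k\<le>n. of_int (q k) * e (i - k)\<bar> \<le> \<rho>"
      using abs_recurrence_defect_geometric_le[OF i, of "of_int (v 0)" "start_range B" q \<eta>]
        v(2) v(4)[OF i]
      by (simp add: \<rho>_def flip: of_int_abs)
    also have "\<dots> \<le> 1 / B * \<bar>real_of_int (q 0)\<bar>" using \<rho> B by (simp add: field_simps)
    finally show ?thesis .
  qed
  have "\<bar>e i\<bar> \<le> (real n * D + 1) ^ N / B" if i: "i \<le> N" for i
  proof -
    have "\<bar>e i\<bar> \<le> 1 / B * (real n * D + 1) ^ i"
      using linear_recurrence_growth[OF n(1), of "\<lambda>k. of_int (q k)" D e "1 / B" N i]
        q0 D v(3) defect i by (simp add: e_def)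
    also have "\<dots> \<le> 1 / B * (real n * D + 1) ^ N"
      using i by (intro mult_left_mono power_increasing) auto
    finally show ?thesis by simp
  qed
  with v(1,2) show thesis by (intro that) (auto simp: approximates_powers_def e_def)
qed

end

end

section \<open>From small values to simultaneous approximations\<close>

lemma mult_power_Suc_le:
  fixes B W Y Z :: "'a :: linordered_semidom"
  assumes "1 \<le> n" "0 \<le> B" "0 \<le> W" "W \<le> Y" "W \<le> Z"
  shows "B * (B ^ (n - 1) * W ^ (m + 1)) \<le> B ^ n * Y ^ m * Z"
proof -
  have "B * (B ^ (n - 1) * W ^ (m + 1)) = B ^ n * W ^ m * W"
    using \<open>1 \<le> n\<close> by (simp add: power_eq_if[of B n] mult_ac)
  also have "\<dots> \<le> B ^ n * Y ^ m * Z"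
    using assms order_trans by (intro mult_mono mult_left_mono power_mono) auto
  finally show ?thesis .
qed

lemma start_range_translate_le:
  fixes P :: "int poly" and a :: int and n N D B :: nat and G :: real
  defines "q \<equiv> coeff (pcompose P [:a, 1:])"
    and "G \<equiv> 3 * (real (n + 1) * D + 1) * (\<Sum>k\<le>n. \<bar>real_of_int a\<bar> ^ k)"
  assumes "1 \<le> n" "degree P \<le> n"
  shows "start_range q D n N B \<le> real B ^ (n - 1) * (G * height P) ^ (N - n + 1)"
    and "B * start_range q D n N B \<le> real B ^ n * (G * height P) ^ (N - n) * (G * \<bar>real_of_int (q 0)\<bar>)"
proof -
  define F where "F = 3 * (real (n + 1) * D + 1)"
  define S where "S = (\<Sum>k\<le>n. \<bar>real_of_int a\<bar> ^ k)"
  let ?W = "F * \<bar>real_of_int (q 0)\<bar>"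
  have F: "0 \<le> F" by (simp add: F_def)
  have "?W \<le> F * (height P * S)"
    unfolding q_def S_def using F abs_eval_int_poly_le[OF \<open>degree P \<le> n\<close>, of "of_int a"]
    by (intro mult_left_mono) (auto simp: eval_int_poly_of_int)
  then have W_height: "?W \<le> G * height P" by (simp add: G_def F_def S_def mult_ac)
  have "F * 1 * \<bar>real_of_int (q 0)\<bar> \<le> F * S * \<bar>real_of_int (q 0)\<bar>"
    unfolding S_def using F by (intro mult_right_mono mult_left_mono one_le_sum_powers) auto
  then have W_q0: "?W \<le> G * \<bar>real_of_int (q 0)\<bar>" by (simp add: G_def F_def S_def)
  have "real (3 * ((n + 1) * D + 1) * nat \<bar>q 0\<bar>) = ?W" by (simp add: F_def algebra_simps)
  then have eq: "real (start_range q D n N B) = real B ^ (n - 1) * ?W ^ (N - n + 1)"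
    by (simp only: start_range_def of_nat_mult[of "B ^ (n - 1)"] of_nat_power)
  show "start_range q D n N B \<le> real B ^ (n - 1) * (G * height P) ^ (N - n + 1)"
    unfolding eq using F W_height by (intro mult_left_mono power_mono) auto
  show "B * start_range q D n N B \<le> real B ^ n * (G * height P) ^ (N - n) * (G * \<bar>real_of_int (q 0)\<bar>)"
    unfolding of_nat_mult eq using \<open>1 \<le> n\<close> F W_height W_q0 by (intro mult_power_Suc_le) auto
qed

definition going_up_const :: "nat \<Rightarrow> nat \<Rightarrow> nat \<Rightarrow> int \<Rightarrow> real \<Rightarrow> real" where
  "going_up_const n N D a \<zeta> =
     (3 * (real (n + 1) * D + 1) * (\<Sum>k\<le>n. \<bar>real_of_int a\<bar> ^ k)) ^ (N - n + 1) *
     (1 + \<bar>inverse (\<zeta> - of_int a)\<bar>) ^ (N + n)"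

lemma reciprocal_approximates_powers:
  fixes \<zeta> :: real and a :: int and n N D :: nat
  defines "\<eta> \<equiv> inverse (\<zeta> - of_int a)" and "K \<equiv> going_up_const n N D a \<zeta>"
  assumes n: "1 \<le> n" "n \<le> N" and "\<zeta> \<noteq> of_int a" and P: "degree P \<le> n" "P \<noteq> 0"
    and D: "dominant_value D P a"
    and B: "1 \<le> B" and small: "K * real B ^ n * height P ^ (N - n) * \<bar>eval_int_poly P \<zeta>\<bar> \<le> 1"
  obtains v where "v 0 \<noteq> 0"
    "\<bar>real_of_int (v 0)\<bar> * (1 + \<bar>\<eta>\<bar>) ^ N \<le> K * real B ^ (n - 1) * height P ^ (N - n + 1)"
    "approximates_powers N \<eta> ((real n * D + 1) ^ N / B) v"
proof -
  define q where "q = coeff (pcompose P [:a, 1:])"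
  define G where "G = 3 * (real (n + 1) * D + 1) * (\<Sum>k\<le>n. \<bar>real_of_int a\<bar> ^ k)"
  define M where "M = start_range q D n N B"
  let ?H = "real_of_int (height P)" and ?q0 = "\<bar>real_of_int (q 0)\<bar>"
  let ?t = "1 + \<bar>\<eta>\<bar>" and ?p = "\<bar>eval_int_poly P \<zeta>\<bar>"
  have K: "K = G ^ (N - n + 1) * ?t ^ (N + n)" by (simp add: K_def going_up_const_def G_def \<eta>_def)
  have "0 \<le> G" by (auto simp: G_def intro!: mult_nonneg_nonneg sum_nonneg)
  have "0 \<le> ?H" using height_ge_1[OF P(2)] by simp
  have q0: "q 0 = poly P a" by (simp add: q_def)
  have "q 0 \<noteq> 0" unfolding q0 by (rule dominant_value_nonzero[OF D P(2)])
  note M_le = start_range_translate_le[OF n(1) P(1), where a = a and D = D and N = N and B = B,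
      folded q_def G_def M_def]
  have "real (B * M) * (?t ^ N * \<bar>\<Sum>k\<le>n. q k * \<eta> ^ (n - k)\<bar>) \<le>
      real B ^ n * (G * ?H) ^ (N - n) * (G * ?q0) * (?t ^ N * (?t ^ n * ?p))"
    using \<open>0 \<le> G\<close> \<open>0 \<le> ?H\<close> abs_sum_reversed_translate_coeffs_le[OF P(1) \<open>\<zeta> \<noteq> of_int a\<close>]
    by (intro mult_mono[OF M_le(2)] mult_left_mono) (auto simp: q_def \<eta>_def)
  also have "\<dots> = ?q0 * (K * real B ^ n * ?H ^ (N - n) * ?p)"
    by (simp add: K power_add power_mult_distrib mult_ac)
  also have "\<dots> \<le> ?q0 * 1" using small by (intro mult_left_mono) auto
  finally have defect: "B * M * ?t ^ N * \<bar>\<Sum>k\<le>n. q k * \<eta> ^ (n - k)\<bar> \<le> ?q0"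
    by (simp add: mult_ac)
  have "\<bar>real_of_int (q k)\<bar> \<le> D * ?q0" for k
    unfolding q0 using D by (simp add: q_def dominant_value_def)
  then obtain v where v: "v 0 \<noteq> 0" "\<bar>v 0\<bar> \<le> int M"
    "approximates_powers N \<eta> ((real n * D + 1) ^ N / B) v"
    using recurrence_approximates_powers[of n N q D B \<eta>] n \<open>q 0 \<noteq> 0\<close> B defect
    unfolding M_def by blast
  have "\<bar>real_of_int (v 0)\<bar> \<le> real M" using v(2) by linarith
  also have "\<dots> \<le> real B ^ (n - 1) * (G * ?H) ^ (N - n + 1)" by (rule M_le(1))
  finally have "\<bar>real_of_int (v 0)\<bar> * ?t ^ N \<le> \<dots> * ?t ^ (N + n)"
    using \<open>0 \<le> G\<close> \<open>0 \<le> ?H\<close> by (intro mult_mono power_increasing) auto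
  with v show thesis
    by (intro that[of v]) (simp_all add: K power_mult_distrib mult_ac del: power_Suc)
qed

lemma powers_approximable_of_small_value:
  fixes \<zeta> :: real and a :: int and n N D :: nat
  assumes n: "1 \<le> n" "n \<le> N" and "\<zeta> \<noteq> of_int a"
  obtains K :: real where "1 \<le> K"
    "\<And>P B. degree P \<le> n \<Longrightarrow> P \<noteq> 0 \<Longrightarrow> dominant_value D P a \<Longrightarrow> K \<le> real B \<Longrightarrow>
       K * real B ^ n * height P ^ (N - n) * \<bar>eval_int_poly P \<zeta>\<bar> \<le> 1 \<Longrightarrow>
       powers_approximable N \<zeta> (K * real B ^ (n - 1) * height P ^ (N - n + 1)) (K / B)"
proof -
  define \<eta> where "\<eta> = inverse (\<zeta> - of_int a)"
  define c where "c = (1 + \<bar>\<zeta> - of_int a\<bar>) * (1 + \<bar>of_int a\<bar>)"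
  define K1 where "K1 = going_up_const n N D a \<zeta>"
  define K2 where "K2 = (real n * D + 1) ^ N * c ^ N"
  have K1: "1 \<le> K1"
    unfolding K1_def going_up_const_def by (intro mult_ge1_I one_le_power one_le_sum_powers) auto
  have K2: "1 \<le> K2" unfolding K2_def c_def by (intro mult_ge1_I one_le_power) auto
  show thesis
  proof (rule that[of "K1 + K2"])
    fix P and B :: nat
    assume P: "degree P \<le> n" "P \<noteq> 0" "dominant_value D P a"
      and B: "K1 + K2 \<le> B"
      and small: "(K1 + K2) * real B ^ n * height P ^ (N - n) * \<bar>eval_int_poly P \<zeta>\<bar> \<le> 1"
    have height: "0 \<le> height P" using height_ge_1[OF P(2)] by simp
    have "K1 * (real B ^ n * height P ^ (N - n) * \<bar>eval_int_poly P \<zeta>\<bar>) \<le>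
        (K1 + K2) * (real B ^ n * height P ^ (N - n) * \<bar>eval_int_poly P \<zeta>\<bar>)"
      using K2 height by (intro mult_right_mono) auto
    with small have "K1 * real B ^ n * height P ^ (N - n) * \<bar>eval_int_poly P \<zeta>\<bar> \<le> 1"
      by (simp add: mult_ac)
    then obtain v where v: "v 0 \<noteq> 0"
      "\<bar>real_of_int (v 0)\<bar> * (1 + \<bar>\<eta>\<bar>) ^ N \<le> K1 * real B ^ (n - 1) * height P ^ (N - n + 1)"
      "approximates_powers N \<eta> ((real n * D + 1) ^ N / B) v"
      using reciprocal_approximates_powers[OF n \<open>\<zeta> \<noteq> of_int a\<close> P, of B thesis] B K1 K2
      unfolding K1_def \<eta>_def by auto
    have error: "(real n * D + 1) ^ N / B * c ^ N = K2 / B" by (simp add: K2_def)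
    have "K2 / B < 1" using B K1 K2 by simp
    then obtain u where u: "u 0 \<noteq> 0" "\<bar>real_of_int (u 0)\<bar> \<le> \<bar>of_int (v 0)\<bar> * (1 + \<bar>\<eta>\<bar>) ^ N"
        "approximates_powers N \<zeta> (K2 / B) u"
      using approximates_powers_of_inverse_translate[OF v(3)[unfolded \<eta>_def] \<open>\<zeta> \<noteq> of_int a\<close> v(1)] n
      unfolding c_def[symmetric] \<eta>_def[symmetric] error by auto
    have "\<bar>real_of_int (u 0)\<bar> \<le> K1 * (real B ^ (n - 1) * height P ^ (N - n + 1))"
      using u(2) v(2) by (simp add: mult_ac)
    also have "\<dots> \<le> (K1 + K2) * (real B ^ (n - 1) * height P ^ (N - n + 1))"
      using K2 height by (intro mult_right_mono) auto
    finally have "\<bar>real_of_int (u 0)\<bar> \<le> (K1 + K2) * real B ^ (n - 1) * height P ^ (N - n + 1)"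
      by (simp add: mult_ac)
    moreover have "approximates_powers N \<zeta> ((K1 + K2) / B) u"
      using K1 by (intro approximates_powers_mono[OF u(3)] divide_right_mono) auto
    ultimately show "powers_approximable N \<zeta> ((K1 + K2) * real B ^ (n - 1) * height P ^ (N - n + 1))
        ((K1 + K2) / B)"
      using u(1) unfolding powers_approximable_def by blast
  qed (use K1 K2 in auto)
qed

lemma nat_near_quotient:
  fixes K y :: real
  assumes "1 \<le> K" "2 * K\<^sup>2 \<le> y"
  obtains B :: nat where "K \<le> B" "K * B \<le> y" "y \<le> 2 * K * B"
proof -
  define B where "B = nat \<lfloor>y / K\<rfloor>"
  have "2 * K \<le> y / K" using assms by (simp add: field_simps power2_eq_square)
  then have "real B \<le> y / K" "y / K - 1 \<le> real B" "2 * K \<le> y / K"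
    using \<open>1 \<le> K\<close> unfolding B_def by linarith+
  with \<open>1 \<le> K\<close> have "K \<le> B" "real B \<le> y / K" "y / K \<le> 2 * B" by linarith+
  with \<open>1 \<le> K\<close> show thesis by (intro that[of B]) (auto simp: field_simps)
qed

lemma small_value_exponent_bounds:
  fixes H K B p w :: real and n N :: nat
  defines "\<beta> \<equiv> (w + real n - real N) / real n" and "\<xi> \<equiv> (w * (real n - 1) + real N) / real n"
  assumes n: "1 \<le> n" "n \<le> N" and K: "1 \<le> K" and H: "1 \<le> H"
    and B: "0 \<le> B" "K * B \<le> H powr \<beta>" and p: "0 \<le> p" "p \<le> H powr (- w)"
  shows "K * B ^ n * H ^ (N - n) * p \<le> 1" and "K * B ^ (n - 1) * H ^ (N - n + 1) \<le> K * H powr \<xi>"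
proof -
  have Hpow: "H ^ k = H powr real k" for k using H by (simp add: powr_realpow)
  have "1 * B \<le> K * B" using K B by (intro mult_right_mono) auto
  with B have "B ^ (n - 1) \<le> (H powr \<beta>) ^ (n - 1)" by (intro power_mono) auto
  also have "\<dots> = H powr (\<beta> * (real n - 1))"
    using H n by (simp add: powr_powr flip: powr_realpow)
  finally have Bpow: "B ^ (n - 1) \<le> H powr (\<beta> * (real n - 1))" .
  have "K * B ^ n * H ^ (N - n) * p = (K * B) * B ^ (n - 1) * H ^ (N - n) * p"
    using n by (simp add: power_eq_if[of B n])
  also have "\<dots> \<le> H powr \<beta> * H powr (\<beta> * (real n - 1)) * H ^ (N - n) * H powr (- w)"
    using B Bpow p K H by (intro mult_mono) auto
  also have "\<dots> = H powr (\<beta> + \<beta> * (real n - 1) + (real N - real n) - w)"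
    using n by (simp add: Hpow powr_add powr_diff powr_minus field_simps)
  also have "\<beta> + \<beta> * (real n - 1) + (real N - real n) - w = 0"
    using n by (simp add: \<beta>_def field_simps)
  finally show "K * B ^ n * H ^ (N - n) * p \<le> 1" using H by simp
  have "K * B ^ (n - 1) * H ^ (N - n + 1) \<le> K * H powr (\<beta> * (real n - 1)) * H ^ (N - n + 1)"
    using Bpow K H by (intro mult_right_mono mult_left_mono) auto
  also have "\<dots> = K * H powr (\<beta> * (real n - 1) + (real N - real n + 1))"
    unfolding Hpow using n by (simp add: powr_add of_nat_diff)
  also have "\<beta> * (real n - 1) + (real N - real n + 1) = \<xi>"
    using n by (simp add: \<beta>_def \<xi>_def field_simps)
  finally show "K * B ^ (n - 1) * H ^ (N - n + 1) \<le> K * H powr \<xi>" .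
qed

lemma powers_approximable_of_small_value_poly:
  fixes \<zeta> w :: real and a :: int and n N D :: nat
  defines "\<beta> \<equiv> (w + real n - real N) / real n" and "\<xi> \<equiv> (w * (real n - 1) + real N) / real n"
  assumes n: "1 \<le> n" "n \<le> N" and "\<zeta> \<noteq> of_int a"
  obtains K :: real where "0 < K"
    "\<And>P. P \<in> small_value_polys n \<zeta> w \<Longrightarrow> dominant_value D P a \<Longrightarrow> K \<le> height P powr \<beta> \<Longrightarrow>
       powers_approximable N \<zeta> (K * height P powr \<xi>) (K * height P powr (- \<beta>))"
proof -
  obtain K where K: "1 \<le> K"
    and approx: "\<And>P B. degree P \<le> n \<Longrightarrow> P \<noteq> 0 \<Longrightarrow> dominant_value D P a \<Longrightarrow> K \<le> real B \<Longrightarrow>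
       K * real B ^ n * height P ^ (N - n) * \<bar>eval_int_poly P \<zeta>\<bar> \<le> 1 \<Longrightarrow>
       powers_approximable N \<zeta> (K * real B ^ (n - 1) * height P ^ (N - n + 1)) (K / B)"
    using powers_approximable_of_small_value[OF n \<open>\<zeta> \<noteq> of_int a\<close>, of D] by metis
  show thesis
  proof (rule that[of "2 * K\<^sup>2"])
    fix P
    assume P: "P \<in> small_value_polys n \<zeta> w" and dominant: "dominant_value D P a"
      and large: "2 * K\<^sup>2 \<le> height P powr \<beta>"
    define H where "H = real_of_int (height P)"
    have nonzero: "P \<noteq> 0" and deg: "degree P \<le> n" and small: "\<bar>eval_int_poly P \<zeta>\<bar> \<le> H powr (- w)"
      using P by (auto simp: small_value_polys_def H_def)
    have H: "1 \<le> H" using height_ge_1[OF nonzero] by (simp add: H_def)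
    obtain B :: nat where B: "K \<le> B" "K * B \<le> H powr \<beta>" "H powr \<beta> \<le> 2 * K * B"
      using nat_near_quotient[OF K large] unfolding H_def .
    note exponents =
      small_value_exponent_bounds[OF n K H of_nat_0_le_iff B(2)[unfolded \<beta>_def] abs_ge_zero small]
    have "powers_approximable N \<zeta> (K * real B ^ (n - 1) * H ^ (N - n + 1)) (K / B)"
      using approx[OF deg nonzero dominant B(1)] exponents(1) by (simp add: H_def)
    moreover have "K * real B ^ (n - 1) * H ^ (N - n + 1) \<le> 2 * K\<^sup>2 * H powr \<xi>"
    proof -
      have "K * H powr \<xi> \<le> 2 * K\<^sup>2 * H powr \<xi>"
        using K by (intro mult_right_mono) (auto simp: power2_eq_square)
      with exponents(2) show ?thesis by (simp add: \<xi>_def)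
    qed
    moreover have "K / B \<le> 2 * K\<^sup>2 * H powr (- \<beta>)"
      using B K H by (simp add: powr_minus field_simps power2_eq_square)
    ultimately show "powers_approximable N \<zeta> (2 * K\<^sup>2 * height P powr \<xi>)
        (2 * K\<^sup>2 * height P powr (- \<beta>))"
      unfolding H_def by (rule powers_approximable_mono)
  qed (use K in auto)
qed

lemma frequently_powers_approximable:
  fixes \<zeta> w :: real and n N :: nat
  defines "\<beta> \<equiv> (w + real n - real N) / real n" and "\<xi> \<equiv> (w * (real n - 1) + real N) / real n"
  assumes n: "1 \<le> n" "n \<le> N" and w: "real N - real n < w"
    and inf: "infinite (small_value_polys n \<zeta> w)"
  obtains K :: real where "0 < K"
    "\<exists>\<^sub>F H in at_top. powers_approximable N \<zeta> (K * H powr \<xi>) (K * H powr (- \<beta>))"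
proof -
  obtain A :: "int set" and D :: nat where A: "finite A" "\<zeta> \<notin> of_int ` A"
    "\<And>P. degree P \<le> n \<Longrightarrow> \<exists>a\<in>A. dominant_value D P a"
    using exists_dominant_value by metis
  have "\<exists>a\<in>A. infinite {P \<in> small_value_polys n \<zeta> w. dominant_value D P a}"
    using A by (intro pigeonhole_infinite_rel[OF inf]) (auto simp: small_value_polys_def)
  then obtain a where "a \<in> A"
    and inf_a: "infinite {P \<in> small_value_polys n \<zeta> w. dominant_value D P a}"
    by blast
  with A(2) have "\<zeta> \<noteq> of_int a" by auto
  then obtain K where K: "0 < K" and approx: "\<And>P. P \<in> small_value_polys n \<zeta> w \<Longrightarrow>
      dominant_value D P a \<Longrightarrow> K \<le> height P powr \<beta> \<Longrightarrow>
      powers_approximable N \<zeta> (K * height P powr \<xi>) (K * height P powr (- \<beta>))"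
    using powers_approximable_of_small_value_poly[OF n, of \<zeta> a w D] unfolding \<beta>_def \<xi>_def by metis
  have "0 < \<beta>" using w n by (simp add: \<beta>_def)
  then have large: "\<forall>\<^sub>F H :: real in at_top. K \<le> H powr \<beta>" by real_asymp
  have "\<exists>\<^sub>F H in at_top. \<exists>P\<in>{P \<in> small_value_polys n \<zeta> w. dominant_value D P a}.
      H = real_of_int (height P)"
    using inf_a by (rule frequently_height[where n = n]) (simp add: small_value_polys_def)
  from frequently_eventually_conj[OF this large] show thesis
    using K approx by (intro that[of K]) (auto elim!: frequently_elim1)
qed

lemma eventually_scaled_powr_le:
  fixes K l \<beta> \<xi> :: real
  assumes "0 < K" "l * \<xi> < \<beta>"
  shows "\<forall>\<^sub>F H in at_top. K * H powr (- \<beta>) \<le> (K * H powr \<xi>) powr (- l)"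
proof -
  have "filterlim (\<lambda>H. H powr (\<beta> - l * \<xi>)) at_top at_top" using \<open>l * \<xi> < \<beta>\<close> by real_asymp
  then have "\<forall>\<^sub>F H in at_top. K * K powr l \<le> H powr (\<beta> - l * \<xi>)" by (simp add: filterlim_at_top)
  with eventually_gt_at_top[of 0] show ?thesis
  proof eventually_elim
    case (elim H)
    then show ?case
      using \<open>0 < K\<close> by (simp add: powr_mult powr_powr powr_minus powr_diff field_simps)
  qed
qed

lemma lambda_exp_ge_if_infinite_small_value_polys:
  fixes \<zeta> w :: real and n N :: nat
  assumes n: "1 \<le> n" "n \<le> N" and w: "real N - real n < w"
    and inf: "infinite (small_value_polys n \<zeta> w)"
  shows "ereal ((w + real n - real N) / (w * (real n - 1) + real N)) \<le> lambda_exp N \<zeta>"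
proof -
  define \<beta> where "\<beta> = (w + real n - real N) / real n"
  define \<xi> where "\<xi> = (w * (real n - 1) + real N) / real n"
  have "0 < w" using w n by simp
  then have "0 < \<xi>" unfolding \<xi>_def using n by (intro divide_pos_pos add_nonneg_pos) auto
  obtain K :: real where K: "0 < K"
    and freq: "\<exists>\<^sub>F H in at_top. powers_approximable N \<zeta> (K * H powr \<xi>) (K * H powr (- \<beta>))"
    using frequently_powers_approximable[OF assms] unfolding \<beta>_def \<xi>_def by metis
  have "ereal l \<le> lambda_exp N \<zeta>" if l: "l < \<beta> / \<xi>" for l
  proof (rule lambda_exp_ge_if_frequently_approximable)
    have "l * \<xi> < \<beta>" using l \<open>0 < \<xi>\<close> by (simp add: field_simps)
    with K have error: "\<forall>\<^sub>F H in at_top. K * H powr (- \<beta>) \<le> (K * H powr \<xi>) powr (- l)"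
      by (rule eventually_scaled_powr_le)
    have "\<exists>\<^sub>F H in at_top. powers_approximable N \<zeta> (K * H powr \<xi>) ((K * H powr \<xi>) powr (- l))"
      using frequently_eventually_conj[OF freq error]
      by (rule frequently_elim1) (auto elim: powers_approximable_mono)
    moreover have "filterlim (\<lambda>H::real. K * H powr \<xi>) at_top at_top" using K \<open>0 < \<xi>\<close> by real_asymp
    ultimately show "\<exists>\<^sub>F X in at_top. powers_approximable N \<zeta> X (X powr (- l))"
      unfolding frequently_def using eventually_compose_filterlim by force
  qed
  then have "z \<le> lambda_exp N \<zeta>" if "z < ereal (\<beta> / \<xi>)" for z
    using that by (cases z) auto
  then have "ereal (\<beta> / \<xi>) \<le> lambda_exp N \<zeta>" by (rule dense_le)
  also have "\<beta> / \<xi> = (w + real n - real N) / (w * (real n - 1) + real N)"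
    using n by (simp add: \<beta>_def \<xi>_def)
  finally show ?thesis .
qed

section \<open>The spectrum inequalities\<close>

definition going_up_bound :: "real \<Rightarrow> nat \<Rightarrow> nat \<Rightarrow> real" where
  "going_up_bound c n N =
     real N * (c * real n + real n - real N) / (c * real n * (real n - 1) + real N)"

lemma going_up_bound_le:
  assumes "1 \<le> n" "n \<le> N" "real N < (c + 1) * real n" "ereal (c * real n) < w_exp n \<zeta>"
  shows "ereal (going_up_bound c n N) \<le> ereal (real N) * lambda_exp N \<zeta>"
proof -
  have "ereal ((c * real n + real n - real N) / (c * real n * (real n - 1) + real N)) \<le>
      lambda_exp N \<zeta>"
    using assms
    by (intro lambda_exp_ge_if_infinite_small_value_polys infinite_small_value_polys)
      (auto simp: algebra_simps)
  from ereal_mult_left_mono[OF this, of "ereal (real N)"] show ?thesis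
    by (simp add: going_up_bound_def)
qed

lemma going_up_bound_tendsto:
  fixes n N :: "'a \<Rightarrow> nat" and c t :: real
  assumes c: "0 < c" and n: "filterlim n at_top F"
    and t: "((\<lambda>k. real (N k) / real (n k)) \<longlongrightarrow> t) F"
  shows "((\<lambda>k. going_up_bound c (n k) (N k)) \<longlongrightarrow> t * (c + 1 - t) / c) F"
proof -
  define r where "r k = real (N k) / real (n k)" for k
  define d where "d k = 1 / real (n k)" for k
  have "filterlim (\<lambda>k. real (n k)) at_top F"
    by (rule filterlim_compose[OF filterlim_real_sequentially n])
  then have d: "(d \<longlongrightarrow> 0) F"
    unfolding d_def[abs_def]
    by (intro tendsto_divide_0[OF tendsto_const] filterlim_at_top_imp_at_infinity)
  have "((\<lambda>k. r k * (c + 1 - r k) / (c * (1 - d k) + r k * d k)) \<longlongrightarrow>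
      t * (c + 1 - t) / (c * (1 - 0) + t * 0)) F"
    using c t unfolding r_def[symmetric] by (intro tendsto_intros d) auto
  moreover have "\<forall>\<^sub>F k in F. r k * (c + 1 - r k) / (c * (1 - d k) + r k * d k) =
      going_up_bound c (n k) (N k)"
    using eventually_compose_filterlim[OF eventually_gt_at_top[of 0] n]
  proof eventually_elim
    case (elim k)
    have "r k * (c + 1 - r k) =
        real (N k) * (c * real (n k) + real (n k) - real (N k)) / (real (n k))\<^sup>2"
      and "c * (1 - d k) + r k * d k =
        (c * real (n k) * (real (n k) - 1) + real (N k)) / (real (n k))\<^sup>2"
      using elim by (simp_all add: r_def d_def field_simps power2_eq_square)
    then show ?case using elim by (simp add: going_up_bound_def)
  qed
  ultimately show ?thesis by (auto dest: Lim_transform_eventually)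
qed

lemma nat_floor_mult_tendsto:
  fixes t :: real
  assumes "0 < t"
  shows "(\<lambda>k. real (nat \<lfloor>t * real k\<rfloor>) / real k) \<longlonglongrightarrow> t"
    and "filterlim (\<lambda>k. nat \<lfloor>t * real k\<rfloor>) at_top sequentially"
proof -
  have eq: "real (nat \<lfloor>t * real k\<rfloor>) = of_int \<lfloor>t * real k\<rfloor>" for k using assms by simp
  show "(\<lambda>k. real (nat \<lfloor>t * real k\<rfloor>) / real k) \<longlonglongrightarrow> t"
    unfolding eq using assms by real_asymp
  have "filterlim (\<lambda>k. real_of_int \<lfloor>t * real k\<rfloor>) at_top sequentially"
    using assms by real_asymp
  then show "filterlim (\<lambda>k. nat \<lfloor>t * real k\<rfloor>) at_top sequentially"
    unfolding eq[symmetric] by (simp add: filterlim_sequentially_iff_filterlim_real)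
qed

lemma le_Limsup_if_frequently:
  fixes f :: "'b \<Rightarrow> ereal"
  assumes r: "filterlim r G F" and g: "(g \<longlongrightarrow> L) F" and le: "\<exists>\<^sub>F x in F. g x \<le> f (r x)"
  shows "L \<le> Limsup G f"
proof (rule ccontr)
  assume "\<not> L \<le> Limsup G f"
  then obtain s where s: "Limsup G f < s" "s < L" using dense by (auto simp: not_le)
  have "\<forall>\<^sub>F x in F. f (r x) < s"
    using Limsup_lessD[OF s(1)] r by (rule eventually_compose_filterlim)
  moreover have "\<forall>\<^sub>F x in F. s < g x" using g s(2) by (rule order_tendstoD)
  ultimately have "\<forall>\<^sub>F x in F. \<not> g x \<le> f (r x)" by eventually_elim (use less_trans in force)
  with le show False by (simp add: frequently_def)
qed

lemma lambda_upper_ge: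
  assumes c: "0 < c" "ereal c < w_upper \<zeta>" and t: "1 \<le> t" "t < c + 1"
  shows "ereal (t * (c + 1 - t) / c) \<le> lambda_upper \<zeta>"
  unfolding lambda_upper_def
proof (rule le_Limsup_if_frequently)
  define N where "N n = nat \<lfloor>t * real n\<rfloor>" for n
  show "filterlim N sequentially sequentially"
    unfolding N_def[abs_def] using t by (intro nat_floor_mult_tendsto) simp
  show "(\<lambda>n. ereal (going_up_bound c n (N n))) \<longlonglongrightarrow> ereal (t * (c + 1 - t) / c)"
    unfolding N_def using c t
    by (intro tendsto_ereal going_up_bound_tendsto nat_floor_mult_tendsto filterlim_ident) auto
  have "\<not> (\<forall>\<^sub>F n in sequentially. w_exp n \<zeta> / ereal (real n) \<le> ereal c)"
    using c(2) Limsup_bounded unfolding w_upper_def by (metis linorder_not_le)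
  then have "\<exists>\<^sub>F n in sequentially. ereal c < w_exp n \<zeta> / ereal (real n)"
    by (simp add: not_eventually not_le)
  from frequently_eventually_conj[OF this eventually_ge_at_top[of 1]]
  show "\<exists>\<^sub>F n in sequentially.
      ereal (going_up_bound c n (N n)) \<le> ereal (real (N n)) * lambda_exp (N n) \<zeta>"
  proof (rule frequently_elim1, elim conjE)
    fix n :: nat assume n: "1 \<le> n" "ereal c < w_exp n \<zeta> / ereal (real n)"
    have "real (N n) \<le> t * real n" unfolding N_def using t by simp
    also have "\<dots> < (c + 1) * real n" using t n by simp
    finally have "real (N n) < (c + 1) * real n" .
    moreover have "1 * real n \<le> t * real n" using t by (intro mult_right_mono) auto
    then have "n \<le> N n" unfolding N_def by (simp add: le_nat_iff le_floor_iff)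
    moreover have "ereal (c * real n) < w_exp n \<zeta>"
      using n by (simp add: ereal_less_divide_pos mult.commute)
    ultimately show "ereal (going_up_bound c n (N n)) \<le> ereal (real (N n)) * lambda_exp (N n) \<zeta>"
      using n by (intro going_up_bound_le)
  qed
qed

lemma lambda_lower_ge:
  assumes c: "0 < c" "ereal c < w_lower \<zeta>" and t: "1 \<le> t" "t < c + 1"
  shows "ereal (t * (c + 1 - t) / c) \<le> lambda_lower \<zeta>"
proof -
  define n where "n N = nat \<lfloor>1 / t * real N\<rfloor>" for N
  have n: "(\<lambda>N. real (n N) / real N) \<longlonglongrightarrow> 1 / t" "filterlim n sequentially sequentially"
    unfolding n_def using nat_floor_mult_tendsto[of "1 / t"] t by auto
  have ratio: "(\<lambda>N. real N / real (n N)) \<longlonglongrightarrow> t"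
    using tendsto_inverse[OF n(1)] t by (simp add: inverse_eq_divide)
  have "\<forall>\<^sub>F n in sequentially. ereal c < w_exp n \<zeta> / ereal (real n)"
    using c(2) unfolding w_lower_def by (rule less_LiminfD)
  then have "\<forall>\<^sub>F N in sequentially. ereal c < w_exp (n N) \<zeta> / ereal (real (n N))"
    by (rule eventually_compose_filterlim[OF _ n(2)])
  moreover have "\<forall>\<^sub>F N in sequentially. 1 \<le> n N"
    by (rule eventually_compose_filterlim[OF eventually_ge_at_top n(2)])
  moreover have "\<forall>\<^sub>F N in sequentially. real N / real (n N) < c + 1"
    using ratio t(2) by (rule order_tendstoD)
  ultimately have "\<forall>\<^sub>F N in sequentially.
      ereal (going_up_bound c (n N) N) \<le> ereal (real N) * lambda_exp N \<zeta>"
  proof eventually_elim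
    case (elim N)
    have "real (n N) \<le> 1 / t * real N" unfolding n_def using t by simp
    also have "\<dots> \<le> real N" using t by (simp add: field_simps mult_le_cancel_right1)
    finally have "n N \<le> N" by simp
    moreover have "real N < (c + 1) * real (n N)" using elim by (simp add: field_simps)
    moreover have "ereal (c * real (n N)) < w_exp (n N) \<zeta>"
      using elim by (simp add: ereal_less_divide_pos mult.commute)
    ultimately show ?case using elim by (intro going_up_bound_le)
  qed
  then have "liminf (\<lambda>N. ereal (going_up_bound c (n N) N)) \<le> lambda_lower \<zeta>"
    unfolding lambda_lower_def by (rule Liminf_mono)
  moreover have "liminf (\<lambda>N. ereal (going_up_bound c (n N) N)) = ereal (t * (c + 1 - t) / c)"
    using going_up_bound_tendsto[OF c(1) n(2) ratio]
    by (intro lim_imp_Liminf trivial_limit_sequentially tendsto_ereal)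
  ultimately show ?thesis by simp
qed

lemma spectrum_bound_le:
  fixes W \<Lambda> :: ereal
  assumes W: "1 \<le> W"
    and bound: "\<And>c t. 0 < c \<Longrightarrow> ereal c < W \<Longrightarrow> 1 \<le> t \<Longrightarrow> t < c + 1 \<Longrightarrow> ereal (t * (c + 1 - t) / c) \<le> \<Lambda>"
  shows "spectrum_bound W \<le> \<Lambda>"
proof (cases W)
  case PInf
  have "\<Lambda> = \<infinity>"
  proof (rule ereal_top)
    fix B :: real
    define t where "t = max 1 (2 * B)"
    have t: "1 \<le> t" "2 * B \<le> t" by (auto simp: t_def)
    have "t * (2 * t + 1 - t) / (2 * t) = (t + 1) / 2" using t by (simp add: field_simps)
    then have "ereal B \<le> ereal (t * (2 * t + 1 - t) / (2 * t))" using t by simp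
    also have "\<dots> \<le> \<Lambda>" using t PInf by (intro bound) auto
    finally show "ereal B \<le> \<Lambda>" .
  qed
  then show ?thesis by simp
next
  case (real r)
  with W have r: "1 \<le> r" by simp
  define t where "t = (r + 1) / 2"
  have lim: "((\<lambda>c. ereal (t * (c + 1 - t) / c)) \<longlongrightarrow> ereal (t * (r + 1 - t) / r)) (at_left r)"
    using r by (intro tendsto_ereal tendsto_intros) auto
  have "\<forall>\<^sub>F c in at_left r. c \<in> {max 0 (t - 1)<..<r}"
    using r by (intro eventually_at_left_real) (auto simp: t_def)
  then have "\<forall>\<^sub>F c in at_left r. ereal (t * (c + 1 - t) / c) \<le> \<Lambda>"
    by eventually_elim (use r real in \<open>intro bound, auto simp: t_def\<close>)
  then have "ereal (t * (r + 1 - t) / r) \<le> \<Lambda>"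
    by (rule tendsto_upperbound[OF lim]) simp
  also have "t * (r + 1 - t) / r = (r + 1)\<^sup>2 / (4 * r)"
    using r by (simp add: t_def field_simps power2_eq_square)
  also have "ereal \<dots> = spectrum_bound W"
    using r real by (simp add: spectrum_bound_def one_ereal_def)
  finally show ?thesis .
qed (use W in auto)

theorem theorem3p7:
  shows "(\<forall>\<zeta> :: real. \<not> algebraic \<zeta> \<longrightarrow>
            spectrum_bound (w_upper \<zeta>) \<le> lambda_upper \<zeta> \<and>
            spectrum_bound (w_lower \<zeta>) \<le> lambda_lower \<zeta>) \<and>
         (\<forall>\<zeta> :: real. T_number \<zeta> \<longrightarrow>
            limsup (\<lambda>n. ereal (real n) * lambda_exp n \<zeta>) = \<infinity>)"
proof (intro conjI allI impI)
  fix \<zeta> :: real assume "\<not> algebraic \<zeta>"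
  then have w: "1 \<le> w_lower \<zeta>" "1 \<le> w_upper \<zeta>"
    using one_le_w_lower w_lower_le_w_upper order_trans by blast+
  show "spectrum_bound (w_upper \<zeta>) \<le> lambda_upper \<zeta>"
    using w by (intro spectrum_bound_le lambda_upper_ge)
  show "spectrum_bound (w_lower \<zeta>) \<le> lambda_lower \<zeta>"
    using w by (intro spectrum_bound_le lambda_lower_ge)
next
  fix \<zeta> :: real assume "T_number \<zeta>"
  then have w: "w_upper \<zeta> = \<infinity>" by (simp add: T_number_def w_upper_def)
  then have "spectrum_bound (w_upper \<zeta>) \<le> lambda_upper \<zeta>"
    by (intro spectrum_bound_le lambda_upper_ge) auto
  then show "limsup (\<lambda>n. ereal (real n) * lambda_exp n \<zeta>) = \<infinity>"
    by (simp add: w spectrum_bound_def lambda_upper_def)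
qed

end
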